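(* Let $k \geq 3$ be an odd integer. Every $(k,2)$-bipartite graph (not necessarily connected) is antimagic.
   Context: All graphs are finite, simple and undirected. A bipartite graph $G=(X\cup Y,E)$ is a $(k,k')$-bipartite graph (biregular bipartite graph) if every vertex of $X$ has degree $k$ and every vertex of $Y$ has degree $k'$. For a graph $G=(V,E)$ with $m=|E|$, an antimagic labelling is a bijection $f:E\to\{1,2,\ldots,m\}$ such that the vertex sums $\sigma(u)=\sum_{v: uv\in E} f(uv)$, $u\in V$, are pairwise distinct. A graph is antimagic if it admits an antimagic labelling. *)

theory Defs
  imports Main
begin

text \<open>
  A finite simple undirected graph is given by a vertex set \<open>V\<close> and a set \<open>E\<close> of edges, each edge
  being the two-element set of its end vertices. Isolated vertices and the empty graph are allowed.
\<close>

definition simple_graph :: "'a set \<Rightarrow> 'a set set \<Rightarrow> bool" where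
  "simple_graph V E \<longleftrightarrow>
     finite V \<and> (\<forall>e\<in>E. \<exists>u v. u \<in> V \<and> v \<in> V \<and> u \<noteq> v \<and> e = {u, v})"

definition graph_degree :: "'a set set \<Rightarrow> 'a \<Rightarrow> nat" where
  "graph_degree E u = card {v. {u, v} \<in> E}"

definition bipartite_graph :: "'a set \<Rightarrow> 'a set \<Rightarrow> 'a set set \<Rightarrow> bool" where
  "bipartite_graph X Y E \<longleftrightarrow>
     simple_graph (X \<union> Y) E \<and> X \<inter> Y = {} \<and>
     (\<forall>e\<in>E. \<exists>x\<in>X. \<exists>y\<in>Y. e = {x, y})"

definition biregular_bipartite_graph ::
    "nat \<Rightarrow> nat \<Rightarrow> 'a set \<Rightarrow> 'a set \<Rightarrow> 'a set set \<Rightarrow> bool" where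
  "biregular_bipartite_graph k k' X Y E \<longleftrightarrow>
     bipartite_graph X Y E \<and>
     (\<forall>x\<in>X. graph_degree E x = k) \<and> (\<forall>y\<in>Y. graph_degree E y = k')"

definition vertex_sum :: "'a set set \<Rightarrow> ('a set \<Rightarrow> nat) \<Rightarrow> 'a \<Rightarrow> nat" where
  "vertex_sum E f u = (\<Sum>v | {u, v} \<in> E. f {u, v})"

definition antimagic_labelling :: "'a set \<Rightarrow> 'a set set \<Rightarrow> ('a set \<Rightarrow> nat) \<Rightarrow> bool" where
  "antimagic_labelling V E f \<longleftrightarrow>
     bij_betw f E {1..card E} \<and> inj_on (vertex_sum E f) V"

definition antimagic :: "'a set \<Rightarrow> 'a set set \<Rightarrow> bool" where
  "antimagic V E \<longleftrightarrow> (\<exists>f. antimagic_labelling V E f)"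

end

theory Submission
  imports Defs "HOL-Library.Multiset"
begin

text \<open>
  The graph is the subdivision of a \<open>k\<close>-regular loopless multigraph on \<open>X\<close> whose edges are the
  elements of \<open>Y\<close>; let \<open>2 h = |X|\<close>. As \<open>k\<close> is odd, the multigraph decomposes into \<open>h\<close> open
  trails such that every vertex is an end of exactly one of them, and an extremal argument makes all
  trails have at least two edges. At every vertex the half-edges other than the single end are paired
  by the trails passing through it. Each of these \<open>N = h (k - 1)\<close> pairs receives two labels with
  constant sum \<open>C = k |X| + 1\<close>, so that the sum at \<open>x \<in> X\<close> is \<open>(k - 1) C / 2\<close> plus the label of the
  end at \<open>x\<close>, and these are distinct. The ends receive the \<open>h\<close> smallest and the \<open>h\<close> largest labels:
  the sums at the last edges of the trails are below \<open>C - N\<close>, those at the first edges above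
  \<open>C + N\<close>, and those at the inner edges are \<open>C\<close> plus the difference of the ranks in
  \<open>{1..N}\<close> of consecutive pairs. So the ranks have to be chosen with distinct consecutive
  differences. If \<open>k \<ge> 5\<close>, a zigzag does this, and the sums on \<open>X\<close> exceed \<open>2 C\<close>, hence all sums on
  \<open>Y\<close>. If \<open>k = 3\<close>, the sums on \<open>X\<close> are \<open>C\<close> plus end labels, and the differences must moreover
  avoid \<open>{1..h}\<close>.
\<close>

subsection \<open>Ranks with distinct differences\<close>

definition zig :: "(nat \<Rightarrow> bool) \<Rightarrow> nat \<Rightarrow> nat \<Rightarrow> nat" where
  "zig low N e =
     (if low e then 1 + card {i. i < e \<and> low i} else N - card {i. i < e \<and> \<not> low i})"

lemma card_less_Suc_Collect:
  "card {i. i < Suc e \<and> P i} = card {i. i < e \<and> P i} + (if P e then 1 else 0)"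
proof -
  have "{i. i < Suc e \<and> P i} = (if P e then insert e {i. i < e \<and> P i} else {i. i < e \<and> P i})"
    by (auto simp: less_Suc_eq)
  then show ?thesis by simp
qed

lemma card_less_split: "card {i. i < e \<and> P i} + card {i. i < e \<and> \<not> P i} = (e::nat)"
  by (induction e) (simp_all add: card_less_Suc_Collect)

lemma card_less_mono: "a \<le> b \<Longrightarrow> card {i. i < (a::nat) \<and> P i} \<le> card {i. i < b \<and> P i}"
  by (rule card_mono) auto

lemma zig_image:
  assumes "K \<le> N"
  shows "zig low N ` {..<K} = {1..card {i. i < K \<and> low i}} \<union> {N - card {i. i < K \<and> \<not> low i}<..N}"
  using assms
proof (induction K)
  case 0
  then show ?case by simp
next
  case (Suc K)
  let ?U = "card {i. i < K \<and> low i}" and ?T = "card {i. i < K \<and> \<not> low i}"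
  have UT: "?U + ?T = K" by (rule card_less_split)
  show ?case
  proof (cases "low K")
    case True
    then show ?thesis using Suc UT
      by (auto simp: lessThan_Suc card_less_Suc_Collect zig_def atLeastAtMostSuc_conv)
  next
    case False
    have "{N - Suc ?T<..N} = insert (N - ?T) {N - ?T<..N}"
      using UT Suc.prems by auto
    then show ?thesis using Suc UT False
      by (simp add: lessThan_Suc card_less_Suc_Collect zig_def)
  qed
qed

lemma zig_bij_betw:
  assumes "K \<le> N"
  shows "bij_betw (zig low N) {..<K}
    ({1..card {i. i < K \<and> low i}} \<union> {N - card {i. i < K \<and> \<not> low i}<..N})"
proof -
  let ?U = "card {i. i < K \<and> low i}" and ?T = "card {i. i < K \<and> \<not> low i}"
  have UT: "?U + ?T = K" by (rule card_less_split)
  have "card ({1..?U} \<union> {N - ?T<..N}) = card {..<K}"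
    using UT assms by (subst card_Un_disjoint) auto
  then have "inj_on (zig low N) {..<K}"
    by (intro eq_card_imp_inj_on) (simp_all add: zig_image[OF assms])
  then show ?thesis
    using zig_image[OF assms] by (simp add: bij_betw_def)
qed

text \<open>The numbers of bottom and of top values used before step \<open>e\<close> add up to
  \<open>e\<close>, so at a change of side the size of the step depends on \<open>e\<close> alone
  and falls strictly with \<open>e\<close>.\<close>

lemma zig_step:
  assumes "low e \<noteq> low (Suc e)" and "Suc e < N"
  shows "int (zig low N (Suc e)) - int (zig low N e) =
    (if low e then int N - 1 - int e else - (int N - 1 - int e))"
  using assms card_less_split[of e low]
  by (auto simp: zig_def card_less_Suc_Collect)

section \<open>Positions in a concatenation of blocks of lengths \<open>w 0\<close>,
  \<open>w 1\<close>, ..\<close>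

definition pos :: "(nat \<Rightarrow> nat) \<Rightarrow> nat \<Rightarrow> nat \<Rightarrow> nat" where
  "pos w j l = sum w {..<j} + l"

lemma pos_bij_betw:
  "bij_betw (\<lambda>(j, l). pos w j l) (SIGMA j:{..<h}. {..<w j}) {..<sum w {..<h}}"
proof (induction h)
  case 0
  then show ?case by (simp add: bij_betw_def)
next
  case (Suc h)
  have "bij_betw (\<lambda>(j, l). pos w j l) ({h} \<times> {..<w h}) {sum w {..<h}..<sum w {..<h} + w h}"
    by (rule bij_betw_byWitness[where f' = "\<lambda>e. (h, e - sum w {..<h})"]) (auto simp: pos_def)
  then have "bij_betw (\<lambda>(j, l). pos w j l) ((SIGMA j:{..<h}. {..<w j}) \<union> {h} \<times> {..<w h})
     ({..<sum w {..<h}} \<union> {sum w {..<h}..<sum w {..<h} + w h})"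
    by (rule bij_betw_combine[OF Suc]) auto
  moreover have "(SIGMA j:{..<h}. {..<w j}) \<union> {h} \<times> {..<w h} = (SIGMA j:{..<Suc h}. {..<w j})"
    by (auto simp: less_Suc_eq)
  moreover have "{..<sum w {..<h}} \<union> {sum w {..<h}..<sum w {..<h} + w h} = {..<sum w {..<Suc h}}"
    by auto
  ultimately show ?case by simp
qed

lemma pos_inj:
  "pos w j l = pos w j' l' \<Longrightarrow> l < w j \<Longrightarrow> l' < w j' \<Longrightarrow> j = j' \<and> l = l'"
proof -
  assume a: "pos w j l = pos w j' l'" "l < w j" "l' < w j'"
  have "inj_on (\<lambda>(j, l). pos w j l) (SIGMA j:{..<Suc (max j j')}. {..<w j})"
    using pos_bij_betw bij_betw_def by blast
  from inj_onD[OF this, of "(j, l)" "(j', l')"] a show ?thesis by auto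
qed

lemma pos_less: "l < w j \<Longrightarrow> j < h \<Longrightarrow> pos w j l < sum w {..<h}"
  using bij_betwE[OF pos_bij_betw[of w h]] by fastforce

lemma pos_less_block: "l < w j \<Longrightarrow> j < j' \<Longrightarrow> pos w j l < pos w j' l'"
  using pos_less[of l w j j'] by (simp add: pos_def)

text \<open>One alternating zigzag runs through all blocks in turn; steps from one block to the next
  are dropped. All sizes are positive, so a step up never equals a step down, and steps in the same
  direction differ in size.\<close>

lemma graceful_rank_large:
  assumes N: "N = (\<Sum>j<h. L j)"
  obtains r :: "nat \<Rightarrow> nat \<Rightarrow> nat" where
    "bij_betw (\<lambda>(j, l). r j l) (SIGMA j:{..<h}. {..<L j}) {1..N}"
    "inj_on (\<lambda>(j, l). int (r j (Suc l)) - int (r j l)) (SIGMA j:{..<h}. {..<L j - 1})"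
proof
  define r where "r j l = zig even N (pos L j l)" for j l
  let ?U = "card {i. i < N \<and> even i}" and ?T = "card {i. i < N \<and> odd i}"
  have "?U + ?T = N" by (rule card_less_split)
  then have "{1..?U} \<union> {N - ?T<..N} = {1..N}" by auto
  then have zb: "bij_betw (zig even N) {..<N} {1..N}"
    using zig_bij_betw[of N N even] by simp
  have "bij_betw (zig even N \<circ> (\<lambda>(j, l). pos L j l)) (SIGMA j:{..<h}. {..<L j}) {1..N}"
    using bij_betw_trans[OF pos_bij_betw zb[unfolded N]] by (simp add: N)
  then show "bij_betw (\<lambda>(j, l). r j l) (SIGMA j:{..<h}. {..<L j}) {1..N}"
    by (simp add: r_def comp_def case_prod_unfold)
  have d: "int (r j (Suc l)) - int (r j l) =
     (if even (pos L j l) then int N - 1 - int (pos L j l) else - (int N - 1 - int (pos L j l)))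
     \<and> Suc (pos L j l) < N"
    if "j < h" "l < L j - 1" for j l
  proof -
    have e: "pos L j (Suc l) = Suc (pos L j l)" by (simp add: pos_def)
    then have "Suc (pos L j l) < N"
      using pos_less[of "Suc l" L j h] that N by simp
    then show ?thesis
      using zig_step[of even "pos L j l" N] unfolding r_def e by simp
  qed
  show "inj_on (\<lambda>(j, l). int (r j (Suc l)) - int (r j l)) (SIGMA j:{..<h}. {..<L j - 1})"
  proof (rule inj_onI, clarsimp, goal_cases)
    case (1 j l j' l')
    then have "pos L j l = pos L j' l'"
      using d[of j l] d[of j' l'] by (auto split: if_splits)
    then show ?case using pos_inj[of L j l j' l'] 1 by simp
  qed
qed

text \<open>Every trail ends in a value from the middle block; its remaining values alternate between
  the bottom and the top block so that the value before the last one is a top value. Hence the last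
  step goes down, every step up exceeds \<open>h\<close>, and since the bottom block has at least one value for
  every \<open>L j \<ge> 3\<close>, the last steps are shorter than all the other ones.\<close>
lemma graceful_rank_cubic:
  fixes L :: "nat \<Rightarrow> nat"
  assumes sum_L: "(\<Sum>j<h. L j) = 2 * h"
    and L_pos: "\<And>j. j < h \<Longrightarrow> 1 \<le> L j"
    and ones: "\<And>i j. i < j \<Longrightarrow> j < h \<Longrightarrow> L j = 1 \<Longrightarrow> L i = 1"
    and twos: "\<And>i j. i < j \<Longrightarrow> j < h \<Longrightarrow> L i = 2 \<Longrightarrow> L j = 2"
  obtains r :: "nat \<Rightarrow> nat \<Rightarrow> nat" where
    "bij_betw (\<lambda>(j, l). r j l) (SIGMA j:{..<h}. {..<L j}) {1..2 * h}"
    "inj_on (\<lambda>(j, l). int (r j (Suc l)) - int (r j l)) (SIGMA j:{..<h}. {..<L j - 1})"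
    "\<And>j l. j < h \<Longrightarrow> l < L j - 1 \<Longrightarrow> int (r j (Suc l)) - int (r j l) \<notin> {1..int h}"
proof
  define w where "w j = L j - 1" for j
  define low where "low e \<longleftrightarrow> (\<exists>j l. j < h \<and> l < w j \<and> e = pos w j l \<and> even (w j - l))" for e
  define U where "U = card {i. i < h \<and> low i}"
  define T where "T = card {i. i < h \<and> \<not> low i}"
  \<comment> \<open>The zigzag has total length \<open>h\<close>, so exactly the \<open>h\<close>
    values in \<open>{U<..U + h}\<close> are left over; they go to the last places of the blocks in
    increasing order.\<close>
  define r where "r j l = (if l < w j then zig low (2 * h) (pos w j l) else Suc (U + j))" for j l
  have UT: "U + T = h"
    unfolding U_def T_def by (rule card_less_split)
  have Lw: "L j = Suc (w j)" if "j < h" for j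
    using L_pos[OF that] by (simp add: w_def)
  have "(\<Sum>j<h. L j) = (\<Sum>j<h. w j + 1)"
    by (rule sum.cong) (simp_all add: Lw)
  then have sum_w: "(\<Sum>j<h. w j) = h"
    using sum_L unfolding sum.distrib by simp
  have low_pos: "low (pos w j l) \<longleftrightarrow> even (w j - l)" if "j < h" "l < w j" for j l
    unfolding low_def using that pos_inj by metis
  have pos_h: "pos w j l < h" if "j < h" "l < w j" for j l
    using pos_less[of l w j h] that sum_w by simp

  show "bij_betw (\<lambda>(j, l). r j l) (SIGMA j:{..<h}. {..<L j}) {1..2 * h}"
  proof -
    have "bij_betw (zig low (2 * h)) {..<h} ({1..U} \<union> {2 * h - T<..2 * h})"
      unfolding U_def T_def by (rule zig_bij_betw) simp
    from bij_betw_trans[OF pos_bij_betw[of w h, unfolded sum_w] this]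
    have "bij_betw (\<lambda>(j, l). r j l) (SIGMA j:{..<h}. {..<w j}) ({1..U} \<union> {2 * h - T<..2 * h})"
      by (rule bij_betw_cong[THEN iffD1, rotated]) (auto simp: r_def)
    moreover have "bij_betw (\<lambda>(j, l). r j l) (SIGMA j:{..<h}. {w j}) {U<..2 * h - T}"
      using UT by (intro bij_betw_byWitness[where f' = "\<lambda>v. (v - Suc U, w (v - Suc U))"])
        (auto simp: r_def)
    ultimately have "bij_betw (\<lambda>(j, l). r j l)
        ((SIGMA j:{..<h}. {..<w j}) \<union> (SIGMA j:{..<h}. {w j}))
        (({1..U} \<union> {2 * h - T<..2 * h}) \<union> {U<..2 * h - T})"
      by (rule bij_betw_combine) (use UT in auto)
    moreover have "(SIGMA j:{..<h}. {..<w j}) \<union> (SIGMA j:{..<h}. {w j}) = (SIGMA j:{..<h}. {..<L j})"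
      using Lw by auto
    moreover have "({1..U} \<union> {2 * h - T<..2 * h}) \<union> {U<..2 * h - T} = {1..2 * h}"
      using UT by auto
    ultimately show ?thesis by simp
  qed

  \<comment> \<open>Since \<open>Suc (pos w j l) < h\<close>, the size
    \<open>2 * h - 1 - pos w j l\<close> exceeds \<open>h\<close>, which keeps the steps up out of
    \<open>{1..h}\<close>.\<close>
  have inner: "int (r j (Suc l)) - int (r j l) =
      (if even (w j - l) then int (2 * h) - 1 - int (pos w j l)
       else - (int (2 * h) - 1 - int (pos w j l))) \<and> Suc (pos w j l) < h"
    if "j < h" "Suc l < w j" for j l
  proof -
    have e: "pos w j (Suc l) = Suc (pos w j l)" by (simp add: pos_def)
    have "even (w j - l) \<noteq> even (w j - Suc l)"
      using that by (metis Suc_diff_Suc Suc_lessD even_Suc)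
    then have "low (pos w j l) \<noteq> low (Suc (pos w j l))"
      using low_pos[of j l] low_pos[of j "Suc l"] that by (simp add: e)
    moreover have "Suc (pos w j l) < h"
      using pos_h[of j "Suc l"] that by (simp add: e)
    ultimately show ?thesis
      using zig_step[of low "pos w j l" "2 * h"] that low_pos[of j l]
      by (simp add: r_def e)
  qed
  \<comment> \<open>\<open>tb j\<close> counts the top values used before place
    \<open>w j - 1\<close> of block \<open>j\<close>, whose own value is therefore
    \<open>2 * h - tb j\<close>.\<close>
  define tb where "tb j = card {i. i < pos w j (w j - 1) \<and> \<not> low i}" for j
  have tb_Suc: "card {i. i < Suc (pos w j (w j - 1)) \<and> \<not> low i} = Suc (tb j)"
    if "j < h" "0 < w j" for j
    using low_pos[of j "w j - 1"] that by (simp add: tb_def card_less_Suc_Collect)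
  have tb_T: "tb j < T" if "j < h" "0 < w j" for j
  proof -
    have "Suc (pos w j (w j - 1)) \<le> h"
      using pos_h[of j "w j - 1"] that by simp
    from card_less_mono[OF this, of "\<lambda>i. \<not> low i"] tb_Suc[OF that] show ?thesis
      by (simp add: T_def)
  qed
  have last: "int (r j (Suc l)) - int (r j l) = int U + 1 + int j + int (tb j) - 2 * int h"
    if "j < h" "Suc l = w j" for j l
  proof -
    have l: "l = w j - 1" and pos: "0 < w j" using that by auto
    have "\<not> low (pos w j l)" using low_pos[of j l] that l by simp
    then show ?thesis
      using that tb_T[OF that(1) pos] UT by (simp add: r_def zig_def tb_def l of_nat_diff)
  qed
  \<comment> \<open>Every block with \<open>0 < w j\<close> spends a top value on its place
    \<open>w j - 1\<close>. So \<open>tb\<close> grows strictly along these blocks, and the last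
    steps, governed by \<open>j + tb j\<close>, are distinct.\<close>
  have last_mono: "tb i < tb j" if "i < j" "j < h" "0 < w i" "0 < w j" for i j
  proof -
    have "Suc (pos w i (w i - 1)) \<le> pos w j (w j - 1)"
      using pos_less_block[of "w i - 1" w i j "w j - 1"] that by simp
    from card_less_mono[OF this, of "\<lambda>i. \<not> low i"] tb_Suc[of i] that show ?thesis
      by (simp add: tb_def)
  qed

  define p where "p = card {i. i < h \<and> L i = 1}"
  define f where "f = card {i. i < h \<and> 3 \<le> L i}"
  \<comment> \<open>A block with \<open>3 \<le> L j\<close> has the low place
    \<open>w j - 2\<close>, just before its final top place; distinct blocks give distinct
    places.\<close>
  have "f \<le> U"
    unfolding f_def U_def
  proof (rule card_inj_on_le)
    show "inj_on (\<lambda>j. pos w j (w j - 2)) {i. i < h \<and> 3 \<le> L i}"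
    proof (rule inj_onI, clarsimp)
      fix i j assume "3 \<le> L i" "3 \<le> L j" "pos w i (w i - 2) = pos w j (w j - 2)"
      moreover from this have "w i - 2 < w i" "w j - 2 < w j" by (auto simp: w_def)
      ultimately show "i = j" using pos_inj by blast
    qed
    show "(\<lambda>j. pos w j (w j - 2)) ` {i. i < h \<and> 3 \<le> L i} \<subseteq> {i. i < h \<and> low i}"
    proof clarify
      fix j assume "j < h" "3 \<le> L j"
      then have l: "w j - 2 < w j" and "w j - (w j - 2) = 2" by (auto simp: w_def)
      then have "low (pos w j (w j - 2)) \<longleftrightarrow> even (2::nat)"
        using low_pos[OF \<open>j < h\<close> l] by (simp only:)
      then show "pos w j (w j - 2) < h \<and> low (pos w j (w j - 2))"
        using pos_h[OF \<open>j < h\<close> l] by simp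
    qed
  qed simp
  \<comment> \<open>The average of \<open>L\<close> is 2, so the excess of the long blocks over 2
    balances the deficit \<open>p\<close> of the blocks of length 1. The identity is proved with all
    terms added, to avoid truncated subtraction.\<close>
  have long: "(\<Sum>i | i < h \<and> 3 \<le> L i. w i) = p + f"
  proof -
    have "(\<Sum>i<h. L i) + (\<Sum>i<h. if 3 \<le> L i then 1 else 0) + (\<Sum>i<h. if L i = 1 then 1 else 0)
        = (\<Sum>i<h. (if 3 \<le> L i then w i else 0) + 2)"
      unfolding sum.distrib[symmetric]
    proof (rule sum.cong[OF refl])
      fix i assume "i \<in> {..<h}"
      then show "L i + (if 3 \<le> L i then 1 else 0) + (if L i = 1 then 1 else 0)
          = (if 3 \<le> L i then w i else 0) + 2"
        using L_pos[of i] by (auto simp: w_def)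
    qed
    moreover have "(\<Sum>i<h. (if 3 \<le> L i then w i else 0) + 2) = (\<Sum>i<h. if 3 \<le> L i then w i else 0) + 2 * h"
      by (subst sum.distrib) simp
    moreover have "{..<h} \<inter> {i. P i} = {i. i < h \<and> P i}" for P by auto
    ultimately show ?thesis
      using sum_L by (simp add: sum.If_cases p_def f_def)
  qed
  \<comment> \<open>Consequently an inner step down is longer than the last step of block
    \<open>j\<close>. By \<open>ones\<close>, all \<open>p\<close> blocks of length 1 precede
    \<open>j\<close>, so \<open>p \<le> j\<close>; by \<open>twos\<close>, no block of length 2
    precedes \<open>j'\<close>, so the position is bounded by the total \<open>p + f\<close> of the
    long blocks.\<close>
  have cross: "pos w j' l' < U + j"
    if j: "j < h" "0 < w j" and j': "j' < h" "Suc l' < w j'" for j j' l'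
  proof -
    have "{i. i < h \<and> L i = 1} \<subseteq> {..<j}"
    proof
      fix i assume "i \<in> {i. i < h \<and> L i = 1}"
      then have i: "i < h" "L i = 1" by auto
      show "i \<in> {..<j}"
      proof (rule ccontr)
        assume "i \<notin> {..<j}"
        then have "L j = 1" using ones[of j i] i by (cases "i = j") auto
        then show False using j by (simp add: w_def)
      qed
    qed
    from card_mono[OF _ this] have "p \<le> j" by (simp add: p_def)
    moreover have "Suc (Suc (pos w j' l')) \<le> sum w {..<Suc j'}"
      using j' by (simp add: pos_def)
    moreover have "sum w {..<Suc j'} = sum w {i. i < Suc j' \<and> 3 \<le> L i}"
    proof (rule sum.mono_neutral_right)
      show "\<forall>i\<in>{..<Suc j'} - {i. i < Suc j' \<and> 3 \<le> L i}. w i = 0"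
      proof
        fix i assume i: "i \<in> {..<Suc j'} - {i. i < Suc j' \<and> 3 \<le> L i}"
        have "L j' \<noteq> 2" using j' by (simp add: w_def)
        then have "L i \<noteq> 2" using twos[of i j'] i j' by (cases "i = j'") auto
        then show "w i = 0" using i by (auto simp: w_def)
      qed
    qed auto
    moreover have "sum w {i. i < Suc j' \<and> 3 \<le> L i} \<le> sum w {i. i < h \<and> 3 \<le> L i}"
      using j' by (intro sum_mono2) auto
    ultimately show ?thesis using long \<open>f \<le> U\<close> by linarith
  qed

  show "int (r j (Suc l)) - int (r j l) \<notin> {1..int h}" if "j < h" "l < L j - 1" for j l
  proof (cases "Suc l < w j")
    case True
    then show ?thesis using inner[of j l] that by auto
  next
    case False
    then have "Suc l = w j" using that by (simp add: w_def)
    then show ?thesis using last[of j l] tb_T[of j] that UT by auto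
  qed
  have less: "int (r j' (Suc l')) - int (r j' l') \<noteq> int (r j (Suc l)) - int (r j l)"
    if "j < h" "Suc l = w j" "j' < h" "Suc l' < w j'" for j l j' l'
    using last[of j l] inner[of j' l'] cross[of j j' l'] tb_T[of j] UT that by auto
  show "inj_on (\<lambda>(j, l). int (r j (Suc l)) - int (r j l)) (SIGMA j:{..<h}. {..<L j - 1})"
  proof (rule inj_onI, clarsimp, goal_cases)
    case (1 j l j' l')
    then have lw: "l < w j" "l' < w j'" by (simp_all add: w_def)
    consider "Suc l < w j" "Suc l' < w j'" | "Suc l = w j" "Suc l' < w j'"
      | "Suc l < w j" "Suc l' = w j'" | "Suc l = w j" "Suc l' = w j'"
      using lw by linarith
    then show ?case
    proof cases
      case 1
      then have "pos w j l = pos w j' l'"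
        using \<open>j < h\<close> \<open>j' < h\<close> inner[of j l] inner[of j' l']
          \<open>int (r j (Suc l)) - int (r j l) = int (r j' (Suc l')) - int (r j' l')\<close>
        by (auto split: if_splits)
      then show ?thesis using pos_inj lw by blast
    next
      case 2
      then show ?thesis using less[of j l j' l'] 1 by simp
    next
      case 3
      then show ?thesis using less[of j' l' j l] 1 by simp
    next
      case 4
      then have "j + tb j = j' + tb j'"
        using last[of j l] last[of j' l'] 1 by simp
      moreover have "0 < w j" "0 < w j'" using lw by auto
      ultimately have "j = j'"
        using last_mono[of j j'] last_mono[of j' j] 1 by (cases j j' rule: linorder_cases) auto
      then show ?thesis using 4 by simp
    qed
  qed
qed

subsection \<open>Trail decompositions\<close>

text \<open>A dart \<open>(x, y)\<close> is the half of the edge \<open>y\<close> of the multigraph at its end vertex \<open>x\<close>. A trail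
  lists the two darts of every traversed edge; the darts in \<open>F\<close> occur only at its two ends.\<close>
inductive trail :: "('a \<times> 'b) set \<Rightarrow> ('a \<times> 'b) set \<Rightarrow> ('a \<times> 'b) list \<Rightarrow> bool" for D F where
  single: "(a, y) \<in> D \<Longrightarrow> (b, y) \<in> D \<Longrightarrow> a \<noteq> b \<Longrightarrow> trail D F [(a, y), (b, y)]"
| join: "trail D F s \<Longrightarrow> trail D F t \<Longrightarrow> fst (last s) = fst (hd t) \<Longrightarrow>
    last s \<notin> F \<Longrightarrow> hd t \<notin> F \<Longrightarrow> trail D F (s @ t)"

lemma trail_length: "trail D F t \<Longrightarrow> 2 \<le> length t \<and> even (length t)"
  by (induction rule: trail.induct) auto

lemma trail_not_Nil: "trail D F t \<Longrightarrow> t \<noteq> []"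
  using trail_length by fastforce

lemma trail_set: "trail D F t \<Longrightarrow> set t \<subseteq> D"
  by (induction rule: trail.induct) auto

lemma trail_rev: "trail D F t \<Longrightarrow> trail D F (rev t)"
proof (induction rule: trail.induct)
  case (single a y b)
  then show ?case by (auto intro: trail.single)
next
  case (join s t)
  then show ?case
    by (auto intro!: trail.join simp: hd_rev last_rev)
qed

lemma trail_hd_neq_last:
  assumes "trail D F t" "distinct t"
  shows "hd t \<noteq> last t"
proof (cases t)
  case (Cons d u)
  moreover have "u \<noteq> []" using trail_length[OF assms(1)] Cons by auto
  ultimately show ?thesis using assms(2) by auto
qed (use assms trail_not_Nil in auto)

lemma trail_mono:
  "trail D F t \<Longrightarrow> F' \<inter> set t \<subseteq> F \<Longrightarrow> trail D F' t"
proof (induction rule: trail.induct)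
  case (single a y b)
  then show ?case by (auto intro: trail.single)
next
  case (join s t)
  moreover have "last s \<in> set s" "hd t \<in> set t"
    using trail_not_Nil[OF join.hyps(1)] trail_not_Nil[OF join.hyps(2)] by auto
  ultimately show ?case
    by (intro trail.join) auto
qed

text \<open>In a distinct trail the last dart is never at a junction, so it may be forbidden there
  too. This is used when the end of a closed trail is moved into the matching.\<close>

lemma trail_insert_last:
  "trail D F t \<Longrightarrow> distinct t \<Longrightarrow> trail D (insert (last t) F) t"
proof (induction rule: trail.induct)
  case (single a y b)
  then show ?case by (auto intro: trail.single)
next
  case (join s t)
  note ne = trail_not_Nil[OF join.hyps(1)] trail_not_Nil[OF join.hyps(2)]
  have "trail D (insert (last t) F) s"
    by (rule trail_mono[OF join.hyps(1)]) (use join.prems ne in auto)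
  moreover have "trail D (insert (last t) F) t"
    using join by auto
  moreover have "hd t \<noteq> last t"
    using trail_hd_neq_last join by auto
  moreover have "last s \<noteq> last t"
    using join.prems ne by (metis IntI distinct_append empty_iff last_in_set)
  ultimately have "trail D (insert (last t) F) (s @ t)"
    using join.hyps by (intro trail.join) auto
  then show ?case using ne by simp
qed

lemma trail_inner_notin:
  "trail D F t \<Longrightarrow> d \<in> set t \<Longrightarrow> d \<in> F \<Longrightarrow> d = hd t \<or> d = last t"
proof (induction rule: trail.induct)
  case (single a y b)
  then show ?case by auto
next
  case (join s t)
  then show ?case
    using trail_not_Nil[OF join.hyps(1)] trail_not_Nil[OF join.hyps(2)] by auto
qed

text \<open>Interior visits of a trail use up the admissible darts at a vertex in pairs.\<close>
lemma trail_parity: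
  "trail D F t \<Longrightarrow> even (length (filter (\<lambda>d. fst d = x \<and> d \<notin> F) t)
     + (if fst (hd t) = x \<and> hd t \<notin> F then 1 else 0)
     + (if fst (last t) = x \<and> last t \<notin> F then 1 else 0))"
proof (induction rule: trail.induct)
  case (single a y b)
  then show ?case by auto
next
  case (join s t)
  then show ?case
    using trail_not_Nil[OF join.hyps(1)] trail_not_Nil[OF join.hyps(2)]
    by (auto split: if_splits)
qed

text \<open>Keeps the first dart of every traversed edge: with the trail oriented from
  \<open>hd\<close> to \<open>last\<close>, these are the half-edges by which it leaves a
  vertex.\<close>

fun tails :: "'c list \<Rightarrow> 'c list" where
  "tails [] = []"
| "tails [d] = [d]"
| "tails (d # e # t) = d # tails t"

lemma tails_append: "even (length s) \<Longrightarrow> tails (s @ t) = tails s @ tails t"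
  by (induction s rule: tails.induct) auto

lemma set_tails: "set (tails t) \<subseteq> set t"
  by (induction t rule: tails.induct) auto

text \<open>An inner visit to \<open>x\<close> has one arriving and one leaving dart; only the start
  leaves without arriving, and only the end arrives without leaving.\<close>

lemma trail_tails_balance:
  "trail D F t \<Longrightarrow> length (filter (\<lambda>d. fst d = x) t) + (if fst (hd t) = x then 1 else 0) =
     2 * length (filter (\<lambda>d. fst d = x) (tails t)) + (if fst (last t) = x then 1 else 0)"
proof (induction rule: trail.induct)
  case (single a y b)
  then show ?case by auto
next
  case (join s t)
  then show ?case
    using trail_not_Nil[OF join.hyps(1)] trail_not_Nil[OF join.hyps(2)] trail_length[OF join.hyps(1)]
    by (auto simp: tails_append split: if_splits)
qed

lemma trail_nth:
  assumes "trail D F t"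
  shows "(\<forall>i. 2 * i + 1 < length t \<longrightarrow> snd (t ! (2 * i)) = snd (t ! (2 * i + 1)))
    \<and> (\<forall>i. 2 * i + 2 < length t \<longrightarrow> fst (t ! (2 * i + 1)) = fst (t ! (2 * i + 2)))"
  using assms
proof (induction rule: trail.induct)
  case (single a y b)
  then show ?case by auto
next
  case (join s t)
  obtain n where n: "length s = 2 * n" "0 < n"
    using trail_length[OF join.hyps(1)] by (auto elim!: evenE)
  have ne: "s \<noteq> []" "t \<noteq> []"
    using trail_not_Nil[OF join.hyps(1)] trail_not_Nil[OF join.hyps(2)] by auto
  show ?case
  proof (intro conjI allI impI)
    fix i assume i: "2 * i + 1 < length (s @ t)"
    show "snd ((s @ t) ! (2 * i)) = snd ((s @ t) ! (2 * i + 1))"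
    proof (cases "i < n")
      case True
      then show ?thesis using join.IH(1) n by (simp add: nth_append)
    next
      case False
      then have "2 * i - length s = 2 * (i - n)" "2 * i + 1 - length s = 2 * (i - n) + 1"
        using n by auto
      then show ?thesis
        using join.IH(2)[THEN conjunct1, rule_format, of "i - n"] False n i by (simp add: nth_append)
    qed
  next
    fix i assume i: "2 * i + 2 < length (s @ t)"
    consider "i + 1 < n" | "i + 1 = n" | "n \<le> i" by linarith
    then show "fst ((s @ t) ! (2 * i + 1)) = fst ((s @ t) ! (2 * i + 2))"
    proof cases
      case 1
      then show ?thesis
        using join.IH(1)[THEN conjunct2, rule_format, of i] n by (simp add: nth_append)
    next
      case 2
      then have "2 * i + 1 = length s - 1" "2 * i + 2 = length s" using n by auto
      then show ?thesis
        using join.hyps(3) ne by (simp add: nth_append last_conv_nth hd_conv_nth)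
    next
      case 3
      then have "2 * i + 1 - length s = 2 * (i - n) + 1" "2 * i + 2 - length s = 2 * (i - n) + 2"
        using n by auto
      then show ?thesis
        using join.IH(2)[THEN conjunct2, rule_format, of "i - n"] 3 n i by (simp add: nth_append)
    qed
  qed
qed

section \<open>Decompositions into trails\<close>

lemma even_sum_list: "(\<And>t. t \<in> set ts \<Longrightarrow> even (f t)) \<Longrightarrow> even (\<Sum>t\<leftarrow>ts. f t :: nat)"
  by (induction ts) auto

definition decomp :: "('a \<times> 'b) set \<Rightarrow> ('a \<times> 'b) set \<Rightarrow> ('a \<times> 'b) list list \<Rightarrow> bool" where
  "decomp D F ts \<longleftrightarrow> (\<forall>t\<in>set ts. trail D F t) \<and> distinct (concat ts) \<and> set (concat ts) = D"

lemma decomp_mset_eq: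
  assumes "decomp D F ts" "mset ts' = mset ts"
  shows "decomp D F ts'"
proof -
  have "mset (concat ts') = mset (concat ts)"
    by (metis assms(2) mset_concat sum_mset_sum_list mset_map)
  then show ?thesis
    using assms mset_eq_setD mset_eq_imp_distinct_iff unfolding decomp_def by metis
qed

lemma decomp_split2:
  assumes "decomp D F ts" "s \<in> set ts" "t \<in> set ts" "s \<noteq> t"
  obtains us where "mset ts = mset (s # t # us)"
proof -
  have "mset ts = add_mset s (mset ts - {#s#})" using assms by simp
  moreover have "t \<in># mset ts - {#s#}"
    using assms by (simp add: in_diff_count)
  then have "mset ts - {#s#} = add_mset t (mset ts - {#s#} - {#t#})"
    by (rule insert_DiffM[symmetric])
  moreover obtain us where "mset us = mset ts - {#s#} - {#t#}"
    using ex_mset by blast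
  ultimately show ?thesis using that[of us] by simp
qed

lemma decomp_mset_concat:
  assumes "decomp D F ts" "\<And>t. t \<in> set ts' \<Longrightarrow> trail D F' t" "mset (concat ts') = mset (concat ts)"
  shows "decomp D F' ts'"
  using assms mset_eq_setD[OF assms(3)] mset_eq_imp_distinct_iff[OF assms(3)]
  unfolding decomp_def by blast

lemma decomp_disjoint:
  assumes "decomp D F ts" "s \<in> set ts" "t \<in> set ts" "s \<noteq> t"
  shows "set s \<inter> set t = {}"
  using assms unfolding decomp_def distinct_concat_iff by auto

text \<open>Only repeated empty lists could escape \<open>distinct (concat ts)\<close>, and a trail
  is never empty.\<close>

lemma decomp_distinct:
  assumes "decomp D F ts"
  shows "distinct ts"
proof -
  have "[] \<notin> set ts" using assms trail_not_Nil unfolding decomp_def by blast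
  then have "removeAll [] ts = ts" by (simp add: removeAll_id)
  then show ?thesis using assms unfolding decomp_def distinct_concat_iff by auto
qed

lemma decomp_filter:
  assumes "decomp D F ts"
  shows "(\<Sum>t\<leftarrow>ts. length (filter P t)) = card {d \<in> D. P d}"
proof -
  have "(\<Sum>t\<leftarrow>ts. length (filter P t)) = length (filter P (concat ts))"
    by (induction ts) auto
  also have "\<dots> = card (set (filter P (concat ts)))"
    using assms by (intro distinct_card[symmetric] distinct_filter) (simp add: decomp_def)
  also have "set (filter P (concat ts)) = {d \<in> D. P d}"
    using assms by (auto simp: decomp_def)
  finally show ?thesis .
qed

definition end_at :: "('a \<times> 'b) set \<Rightarrow> 'a \<Rightarrow> ('a \<times> 'b) list \<Rightarrow> bool" where
  "end_at F x t \<longleftrightarrow> fst (hd t) = x \<and> hd t \<notin> F \<or> fst (last t) = x \<and> last t \<notin> F"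

text \<open>After reversals the two free ends at \<open>x\<close>, those outside \<open>F\<close>,
  face each other and can form a junction. This drives both extremal arguments: with as few trails
  as possible, at most one trail has a free end at a given vertex.\<close>

lemma decomp_join:
  assumes dec: "decomp D F ts" and mem: "s \<in> set ts" "t \<in> set ts" "s \<noteq> t"
    and ends: "end_at F x s" "end_at F x t"
  obtains ts' where "decomp D F ts'" "length ts' < length ts"
proof -
  have tr: "trail D F s" "trail D F t" using dec mem by (auto simp: decomp_def)
  define s' where "s' = (if fst (last s) = x \<and> last s \<notin> F then s else rev s)"
  define t' where "t' = (if fst (hd t) = x \<and> hd t \<notin> F then t else rev t)"
  have "fst (last s') = x" "last s' \<notin> F" "trail D F s'" "mset s' = mset s"
    and "fst (hd t') = x" "hd t' \<notin> F" "trail D F t'" "mset t' = mset t"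
    using ends tr by (auto simp: s'_def t'_def end_at_def last_rev hd_rev trail_rev trail_not_Nil)
  then have st: "trail D F (s' @ t')" "mset (s' @ t') = mset s + mset t"
    by (auto intro: trail.join)
  obtain us where us: "mset ts = mset (s # t # us)"
    using decomp_split2[OF dec mem] by blast
  have dec': "decomp D F (s # t # us)" using decomp_mset_eq[OF dec] us by simp
  have "decomp D F ((s' @ t') # us)"
    by (rule decomp_mset_concat[OF dec']) (use st dec' in \<open>auto simp: decomp_def\<close>)
  moreover have "length ((s' @ t') # us) < length ts"
    using mset_eq_length[OF us] by simp
  ultimately show ?thesis using that by blast
qed

section \<open>Regular multigraphs of odd degree as sets of darts\<close>

locale darts =
  fixes D :: "('a \<times> 'b) set" and k :: nat
  assumes finite_D: "finite D"
    and card_y: "y \<in> snd ` D \<Longrightarrow> card {d \<in> D. snd d = y} = 2"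
    and card_x: "x \<in> fst ` D \<Longrightarrow> card {d \<in> D. fst d = x} = k"
    and k_ge: "3 \<le> k" and k_odd: "odd k"
begin

lemma darts_of_y:
  assumes "d \<in> D" "d' \<in> D" "d \<noteq> d'" "snd d = snd d'"
  shows "{e \<in> D. snd e = snd d} = {d, d'}"
  using assms finite_D card_y[of "snd d"] by (intro card_subset_eq[symmetric]) auto

text \<open>A trail traverses whole edges, and by \<open>card_y\<close> an edge has no third
  dart.\<close>

lemma trail_closed:
  "trail D F t \<Longrightarrow> d \<in> set t \<Longrightarrow> d' \<in> D \<Longrightarrow> snd d' = snd d \<Longrightarrow> d' \<in> set t"
proof (induction rule: trail.induct)
  case (single a y b)
  then have "{e \<in> D. snd e = y} = {(a, y), (b, y)}"
    using darts_of_y[of "(a, y)" "(b, y)"] by simp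
  moreover have "d' \<in> {e \<in> D. snd e = y}" using single by auto
  ultimately have "d' \<in> {(a, y), (b, y)}" by (simp only:)
  then show ?case by simp
next
  case (join s t)
  then show ?case by auto
qed

text \<open>Each edge on its own is a trail without junctions, so \<open>F\<close> imposes no
  restriction.\<close>

lemma decomp_exists: "\<exists>ts. decomp D F ts"
proof -
  have "\<exists>t. trail D F t \<and> set t = {d \<in> D. snd d = y} \<and> distinct t" if y: "y \<in> snd ` D" for y
  proof -
    obtain d d' where d: "{d \<in> D. snd d = y} = {d, d'}" "d \<noteq> d'"
      using card_y[OF y] by (auto simp: card_2_iff)
    then have "d \<in> D" "d' \<in> D" "snd d = y" "snd d' = y" by blast+
    moreover from this d(2) have "fst d \<noteq> fst d'" by (auto simp: prod_eq_iff)
    ultimately have "trail D F [(fst d, y), (fst d', y)]"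
      by (intro trail.single) (metis prod.collapse | assumption)+
    then have "trail D F [d, d']"
      using \<open>snd d = y\<close> \<open>snd d' = y\<close> by (metis prod.collapse)
    then show ?thesis using d by (intro exI[of _ "[d, d']"]) auto
  qed
  then obtain T where T: "\<And>y. y \<in> snd ` D \<Longrightarrow>
      trail D F (T y) \<and> set (T y) = {d \<in> D. snd d = y} \<and> distinct (T y)"
    by metis
  obtain ys where ys: "set ys = snd ` D" "distinct ys"
    using finite_distinct_list[of "snd ` D"] finite_D by blast
  have eq: "y = z" if "y \<in> snd ` D" "z \<in> snd ` D" "set (T y) \<inter> set (T z) \<noteq> {}" for y z
    using T[of y] T[of z] that by auto
  have "inj_on T (snd ` D)"
  proof (rule inj_onI)
    fix y z assume yz: "y \<in> snd ` D" "z \<in> snd ` D" "T y = T z"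
    then have "set (T y) \<noteq> {}" using T[of y] by auto
    then show "y = z" using eq[of y z] yz by simp
  qed
  have "distinct (concat (map T ys))"
  proof (rule distinct_concat)
    show "distinct (map T ys)"
      using ys \<open>inj_on T (snd ` D)\<close> by (simp add: distinct_map)
    show "distinct t" if "t \<in> set (map T ys)" for t
      using that T ys(1) by auto
    show "set t \<inter> set u = {}" if tu: "t \<in> set (map T ys)" "u \<in> set (map T ys)" "t \<noteq> u" for t u
    proof -
      from tu(1,2) obtain y z where "y \<in> snd ` D" "z \<in> snd ` D" "t = T y" "u = T z"
        unfolding set_map ys(1) by blast
      then show ?thesis using eq[of y z] tu(3) by blast
    qed
  qed
  moreover have "set (concat (map T ys)) = D"
  proof -
    have "set (concat (map T ys)) = (\<Union>y\<in>snd ` D. {d \<in> D. snd d = y})"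
      using T ys(1) by simp
    then show ?thesis by auto
  qed
  moreover have "\<forall>t\<in>set (map T ys). trail D F t"
    unfolding set_map ys(1) using T by blast
  ultimately have "decomp D F (map T ys)"
    unfolding decomp_def by blast
  then show ?thesis by blast
qed

lemma inj_on_snd_tails:
  "trail D F t \<Longrightarrow> distinct t \<Longrightarrow> inj_on snd (set (tails t))"
proof (induction rule: trail.induct)
  case (single a y b)
  then show ?case by simp
next
  case (join s t)
  have "snd d \<noteq> snd d'" if "d \<in> set (tails s)" "d' \<in> set (tails t)" for d d'
  proof
    assume "snd d = snd d'"
    moreover have "d \<in> set s" "d' \<in> set t" using that set_tails by fastforce+
    ultimately have "d' \<in> set s"
      using trail_closed[OF join.hyps(1), of d d'] trail_set[OF join.hyps(2)]
        \<open>snd d = snd d'\<close> by auto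
    then show False using join.prems \<open>d' \<in> set t\<close> by auto
  qed
  then have "snd ` set (tails s) \<inter> snd ` set (tails t) = {}" by auto
  then show ?case
    using join trail_length[OF join.hyps(1)]
    by (auto simp: tails_append inj_on_Un)
qed

text \<open>In the bipartite graph, a matching covering the side of the first components: one dart
  at every vertex, on pairwise distinct edges.\<close>

definition matching :: "('a \<times> 'b) set \<Rightarrow> bool" where
  "matching F \<longleftrightarrow> F \<subseteq> D \<and> inj_on fst F \<and> inj_on snd F \<and> fst ` F = fst ` D"

text \<open>In a decomposition into as few trails as possible no two trails have a common end. Orienting
  the trails, every vertex is therefore left by a trail, and any choice of leaving darts is a
  matching.\<close>
lemma matching_exists: "\<exists>F. matching F"
proof -
  obtain ts where dec: "decomp D {} ts" and min: "\<And>ts'. decomp D {} ts' \<Longrightarrow> length ts \<le> length ts'"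
    using decomp_exists ex_has_least_nat[of "decomp D {}" _ length] by metis
  have tr: "trail D {} t" if "t \<in> set ts" for t using dec that by (simp add: decomp_def)
  have tail: "\<exists>t\<in>set ts. \<exists>d\<in>set (tails t). fst d = x" if "x \<in> fst ` D" for x
  proof (rule ccontr)
    assume no: "\<not> ?thesis"
    \<comment> \<open>Without a tail at \<open>x\<close>, the balance allows each trail at most one
      dart at \<open>x\<close>, and then the trail ends there. So \<open>k \<ge> 3\<close> darts
      force two trails ending at \<open>x\<close>, which could be joined.\<close>
    have "(\<Sum>t\<leftarrow>ts. length (filter (\<lambda>d. fst d = x) t)) \<le>
        (\<Sum>t\<leftarrow>ts. if fst (last t) = x then 1 else 0)"
    proof (rule sum_list_mono)
      fix t assume t: "t \<in> set ts"
      then have "filter (\<lambda>d. fst d = x) (tails t) = []"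
        using no by (auto simp: filter_empty_conv)
      then show "length (filter (\<lambda>d. fst d = x) t) \<le> (if fst (last t) = x then 1 else 0)"
        using trail_tails_balance[OF tr[OF t], of x] by simp
    qed
    also have "\<dots> = length (filter (\<lambda>t. fst (last t) = x) ts)"
      by (induction ts) auto
    also have "\<dots> = card {t \<in> set ts. fst (last t) = x}"
      using decomp_distinct[OF dec] by (simp add: distinct_length_filter Int_def conj_commute)
    finally have "k \<le> card {t \<in> set ts. fst (last t) = x}"
      using decomp_filter[OF dec, of "\<lambda>d. fst d = x"] card_x[OF that] by simp
    then have "\<not> card {t \<in> set ts. fst (last t) = x} \<le> Suc 0" using k_ge by simp
    then obtain s t where "s \<in> {t \<in> set ts. fst (last t) = x}" "t \<in> {t \<in> set ts. fst (last t) = x}"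
      "s \<noteq> t"
      using card_le_Suc0_iff_eq[of "{t \<in> set ts. fst (last t) = x}"] by auto
    moreover from this have "end_at {} x s" "end_at {} x t" by (auto simp: end_at_def)
    ultimately obtain ts' where "decomp D {} ts'" "length ts' < length ts"
      using decomp_join[OF dec, of s t x] by auto
    then show False using min[of ts'] by simp
  qed
  define A where "A = (\<Union>t\<in>set ts. set (tails t))"
  have "A \<subseteq> D"
  proof
    fix d assume "d \<in> A"
    then obtain t where "t \<in> set ts" "d \<in> set (tails t)" by (auto simp: A_def)
    then show "d \<in> D" using set_tails[of t] trail_set[OF tr] by blast
  qed
  have inj: "inj_on snd A"
  proof (rule inj_onI)
    fix d d' assume "d \<in> A" "d' \<in> A" and eq: "snd d = snd d'"
    then obtain s t where st: "s \<in> set ts" "d \<in> set (tails s)" "t \<in> set ts" "d' \<in> set (tails t)"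
      by (auto simp: A_def)
    then have "d \<in> set s" "d' \<in> set t" using set_tails[of s] set_tails[of t] by auto
    moreover from this have "d' \<in> set s"
      using trail_closed[OF tr[OF st(1)], of d d'] eq \<open>A \<subseteq> D\<close> \<open>d' \<in> A\<close> by auto
    ultimately have "s = t" using decomp_disjoint[OF dec st(1,3)] by blast
    moreover have "distinct s" using dec st by (auto simp: decomp_def distinct_concat_iff)
    ultimately show "d = d'"
      using inj_on_snd_tails[OF tr[OF st(1)]] st eq by (auto dest: inj_onD)
  qed
  define g where "g x = (SOME d. d \<in> A \<and> fst d = x)" for x
  have g: "g x \<in> A \<and> fst (g x) = x" if "x \<in> fst ` D" for x
  proof -
    have "\<exists>d. d \<in> A \<and> fst d = x" using tail[OF that] unfolding A_def by blast
    then show ?thesis unfolding g_def by (rule someI_ex)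
  qed
  then have sub: "g ` fst ` D \<subseteq> A" by blast
  have "inj_on fst (g ` fst ` D)"
  proof (rule inj_on_imageI, rule inj_onI)
    fix x y assume "x \<in> fst ` D" "y \<in> fst ` D" "(fst \<circ> g) x = (fst \<circ> g) y"
    then show "x = y" using g[of x] g[of y] by simp
  qed
  moreover have "fst ` g ` fst ` D = fst ` D"
  proof -
    have "fst ` g ` fst ` D = (\<lambda>x. x) ` fst ` D"
      unfolding image_image[of fst g] by (rule image_cong[OF refl]) (simp only: g)
    then show ?thesis by (simp only: image_ident)
  qed
  ultimately have "matching (g ` fst ` D)"
    unfolding matching_def
    by (intro conjI subset_trans[OF sub \<open>A \<subseteq> D\<close>] inj_on_subset[OF inj sub])
  then show ?thesis by blast
qed

text \<open>Take a matching and a decomposition respecting it with as few trails as possible. By parity, a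
  trail end outside the matching could only belong to a closed trail; moving the matching dart at its
  base vertex to the other end of the closed trail splices it into the trail containing that dart.\<close>
lemma matching_decomp_exists:
  obtains F ts where "matching F" "decomp D F ts"
    "\<And>t. t \<in> set ts \<Longrightarrow> hd t \<in> F \<and> last t \<in> F"
proof -
  obtain F0 ts0 where "matching F0 \<and> decomp D F0 ts0"
    using matching_exists decomp_exists by blast
  then obtain p where p: "matching (fst p) \<and> decomp D (fst p) (snd p)"
    and min: "\<And>q. matching (fst q) \<and> decomp D (fst q) (snd q) \<Longrightarrow> length (snd p) \<le> length (snd q)"
    using ex_has_least_nat[of "\<lambda>p. matching (fst p) \<and> decomp D (fst p) (snd p)" "(F0, ts0)"
        "\<lambda>p. length (snd p)"] by auto
  obtain F ts where p_eq: "p = (F, ts)" by (cases p)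
  have mat: "matching F" and dec: "decomp D F ts" using p p_eq by auto
  have min: "length ts \<le> length ts'" if "matching F'" "decomp D F' ts'" for F' ts'
    using min[of "(F', ts')"] that p_eq by simp
  have tr: "trail D F t" if "t \<in> set ts" for t using dec that by (simp add: decomp_def)
  have dist: "distinct t" if "t \<in> set ts" for t
    using dec that by (auto simp: decomp_def distinct_concat_iff)
  have ends: "hd t \<in> F \<and> last t \<in> F" if t: "t \<in> set ts" for t
  proof (rule ccontr)
    assume "\<not> (hd t \<in> F \<and> last t \<in> F)"
    then obtain x where x: "end_at F x t" by (auto simp: end_at_def)
    \<comment> \<open>A second trail with a free end at \<open>x\<close> could be joined to
      \<open>t\<close>, against minimality.\<close>
    have other: "\<not> end_at F x s" if "s \<in> set ts" "s \<noteq> t" for s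
      using decomp_join[OF dec that(1) t that(2) _ x] min[OF mat] by (metis linorder_not_le)
    have "hd t \<in> D" "last t \<in> D"
      using trail_set[OF tr[OF t]] trail_not_Nil[OF tr[OF t]] by auto
    then have xD: "x \<in> fst ` D" using x by (auto simp: end_at_def)
    then obtain f where f: "f \<in> F" "fst f = x"
      using mat unfolding matching_def by (metis imageE)
    \<comment> \<open>Exactly one of the \<open>k\<close> darts at \<open>x\<close> is in
      \<open>F\<close>; as \<open>k\<close> is odd, evenly many remain.\<close>
    have "{d \<in> D. fst d = x} = insert f {d \<in> D. fst d = x \<and> d \<notin> F}"
      using mat f unfolding matching_def by (auto dest: inj_onD)
    then have "k = Suc (card {d \<in> D. fst d = x \<and> d \<notin> F})"
      using card_x[OF xD] finite_D f by simp
    then have ev: "even (card {d \<in> D. fst d = x \<and> d \<notin> F})"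
      using k_odd by simp
    let ?c = "\<lambda>t. length (filter (\<lambda>d. fst d = x \<and> d \<notin> F) t)"
    let ?e = "\<lambda>t. (if fst (hd t) = x \<and> hd t \<notin> F then 1 else 0)
      + (if fst (last t) = x \<and> last t \<notin> F then 1 else (0::nat))"
    \<comment> \<open>Summed over all trails, parity makes the number of free ends at
      \<open>x\<close> even. They all belong to \<open>t\<close>, so both ends of \<open>t\<close>
      are free and at \<open>x\<close>.\<close>
    have "even (\<Sum>t\<leftarrow>ts. ?c t + ?e t)"
      using trail_parity[OF tr, of _ x]
      by (intro even_sum_list) (simp add: add.assoc)
    then have "even (\<Sum>t\<leftarrow>ts. ?e t)"
      using decomp_filter[OF dec, of "\<lambda>d. fst d = x \<and> d \<notin> F"] ev
      by (simp add: sum_list_addf)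
    moreover have "(\<Sum>t\<leftarrow>ts. ?e t) = ?e t"
    proof -
      have "(\<Sum>t\<leftarrow>ts. ?e t) = (\<Sum>t\<in>set ts. ?e t)"
        by (rule sum_list_distinct_conv_sum_set[OF decomp_distinct[OF dec]])
      also have "\<dots> = (\<Sum>s\<in>{t}. ?e s)"
        using t other by (intro sum.mono_neutral_right) (auto simp: end_at_def)
      finally show ?thesis by simp
    qed
    ultimately have closed: "fst (hd t) = x" "hd t \<notin> F" "fst (last t) = x" "last t \<notin> F"
      using x by (auto simp: end_at_def split: if_splits)
    have "f \<in> set (concat ts)"
      using dec f(1) mat unfolding decomp_def matching_def by blast
    then obtain s where s: "s \<in> set ts" "f \<in> set s" by auto
    have f_end: "f = hd s \<or> f = last s"
      by (rule trail_inner_notin[OF tr[OF s(1)] s(2) f(1)])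
    have "s \<noteq> t" using f_end f closed by auto
    define s' where "s' = (if f = last s then s else rev s)"
    have s': "last s' = f" "trail D F s'" "mset s' = mset s"
      using f_end tr[OF s(1)] by (auto simp: s'_def last_rev trail_rev trail_not_Nil)
    \<comment> \<open>Exchanging the matching darts at \<open>x\<close> makes \<open>f\<close>
      available as a junction: \<open>s'\<close> arrives by \<open>f\<close>, continues along
      \<open>t\<close> through \<open>hd t\<close>, and stops at \<open>last t\<close>, which is now
      in the matching.\<close>
    define F' where "F' = insert (last t) (F - {f})"
    have last_t: "last t \<in> set t" using trail_not_Nil[OF tr[OF t]] by simp
    have "f \<noteq> last t" using f closed by auto
    have tr': "trail D F' u" if "trail D F u" "last t \<notin> set u" for u
      using that(1) by (rule trail_mono) (use that(2) in \<open>auto simp: F'_def\<close>)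
    obtain us where us: "mset ts = mset (s # t # us)"
      using decomp_split2[OF dec s(1) t \<open>s \<noteq> t\<close>] by blast
    have dec': "decomp D F (s # t # us)" using decomp_mset_eq[OF dec] us by simp
    then have notin: "last t \<notin> set s" "\<And>u. u \<in> set us \<Longrightarrow> last t \<notin> set u"
      using last_t by (auto simp: decomp_def)
    have "trail D F' s'" using tr'[OF s'(2)] notin(1) mset_eq_setD[OF s'(3)] by simp
    moreover have "trail D F' t"
      using trail_insert_last[OF tr[OF t] dist[OF t]] by (rule trail_mono) (auto simp: F'_def)
    moreover have "last s' \<notin> F'" "hd t \<notin> F'"
      using s' \<open>f \<noteq> last t\<close> closed trail_hd_neq_last[OF tr[OF t] dist[OF t]] by (auto simp: F'_def)
    ultimately have "trail D F' (s' @ t)"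
      using s' f closed by (intro trail.join) auto
    then have "decomp D F' ((s' @ t) # us)"
      using s' dec' tr' notin(2)
      by (intro decomp_mset_concat[OF dec']) (auto simp: decomp_def)
    moreover have "matching F'"
    proof -
      have F: "F \<subseteq> D" "inj_on fst F" "inj_on snd F" "fst ` F = fst ` D"
        using mat by (simp_all add: matching_def)
      \<comment> \<open>A dart of \<open>F\<close> on the edge of \<open>last t\<close> would lie on
        \<open>t\<close>, hence be one of its ends, and these are outside \<open>F\<close>.\<close>
      have snd_neq: "snd d \<noteq> snd (last t)" if "d \<in> F" for d
      proof
        assume "snd d = snd (last t)"
        then have "d \<in> set t"
          using trail_closed[OF tr[OF t] last_t, of d] that F(1) by blast
        then have "d = hd t \<or> d = last t"
          by (rule trail_inner_notin[OF tr[OF t] _ that])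
        then show False using that closed(2,4) by (elim disjE) simp_all
      qed
      have fst_eq: "fst d = x \<longleftrightarrow> d = f" if "d \<in> F" for d
        using inj_on_eq_iff[OF F(2) that f(1)] f(2) by simp
      have "snd (last t) \<notin> snd ` (F - {f})"
      proof
        assume "snd (last t) \<in> snd ` (F - {f})"
        then obtain d where "d \<in> F" "snd (last t) = snd d" by blast
        then show False using snd_neq[of d] by simp
      qed
      then have "snd (last t) \<notin> snd ` (F - {f} - {last t})" by blast
      then have "inj_on snd F'"
        unfolding F'_def inj_on_insert by (intro conjI inj_on_subset[OF F(3) Diff_subset])
      moreover have "fst (last t) \<notin> fst ` (F - {f})"
      proof
        assume "fst (last t) \<in> fst ` (F - {f})"
        then obtain d where "d \<in> F" "d \<noteq> f" "fst (last t) = fst d" by blast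
        then show False using fst_eq[of d] closed(3) by simp
      qed
      then have "fst (last t) \<notin> fst ` (F - {f} - {last t})" by blast
      then have "inj_on fst F'"
        unfolding F'_def inj_on_insert by (intro conjI inj_on_subset[OF F(2) Diff_subset])
      moreover have "fst ` F' = fst ` insert f (F - {f})"
        unfolding F'_def image_insert by (simp only: f(2) closed(3))
      then have "fst ` F' = fst ` D"
        by (simp only: insert_Diff[OF f(1)] F(4))
      moreover have "F' \<subseteq> D"
        using F(1) \<open>last t \<in> D\<close> unfolding F'_def by blast
      ultimately show ?thesis
        by (simp only: matching_def simp_thms)
    qed
    ultimately have "length ts \<le> Suc (length us)"
      using min[of F' "(s' @ t) # us"] by simp
    then show False using mset_eq_length[OF us] by simp
  qed
  show ?thesis
    using that mat dec ends by metis
qed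

end

context darts
begin

lemma card_D: "card D = k * card (fst ` D)"
proof -
  have "card D = (\<Sum>x\<in>fst ` D. card {d \<in> D. fst d = x})"
    using sum.image_gen[OF finite_D, of "\<lambda>_. 1::nat" fst] by simp
  then show ?thesis by (simp add: card_x mult.commute)
qed

text \<open>Trail \<open>j\<close> has \<open>L j + 1\<close> edges and thus \<open>L j\<close>
  inner visits. Its two ends account for one dart at each vertex, so there are \<open>2 * h\<close>
  vertices, and counting darts gives the sum of \<open>L\<close>.\<close>

lemma indexed_decomp_exists:
  obtains h and L :: "nat \<Rightarrow> nat" and e where
    "bij_betw (\<lambda>(j, i). e j i) (SIGMA j:{..<h}. {..<2 * L j + 2}) D"
    "\<And>j. j < h \<Longrightarrow> 1 \<le> L j"
    "\<And>j i. j < h \<Longrightarrow> i \<le> L j \<Longrightarrow> snd (e j (2 * i)) = snd (e j (2 * i + 1))"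
    "\<And>j l. j < h \<Longrightarrow> l < L j \<Longrightarrow> fst (e j (2 * l + 1)) = fst (e j (2 * l + 2))"
    "bij_betw (\<lambda>(j, b). fst (e j (if b then 0 else 2 * L j + 1))) ({..<h} \<times> UNIV) (fst ` D)"
    "\<And>i j. i < j \<Longrightarrow> j < h \<Longrightarrow> L j = 1 \<Longrightarrow> L i = 1"
    "\<And>i j. i < j \<Longrightarrow> j < h \<Longrightarrow> L i = 2 \<Longrightarrow> L j = 2"
    "(\<Sum>j<h. L j) = h * (k - 1)"
proof -
  obtain F ts0 where mat: "matching F" and dec0: "decomp D F ts0"
    and ends0: "\<And>t. t \<in> set ts0 \<Longrightarrow> hd t \<in> F \<and> last t \<in> F"
    using matching_decomp_exists by metis
  \<comment> \<open>Lengths 4 and 6 mean \<open>L j = 1\<close> and \<open>L j = 2\<close>. Sorting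
    by \<open>c\<close> puts the former first and the latter last, the order required by
    \<open>graceful_rank_cubic\<close>.\<close>
  define c :: "('a \<times> 'b) list \<Rightarrow> nat"
    where "c t = (if length t = 4 then 0 else if length t = 6 then 2 else 1)" for t
  define ts where "ts = sort_key c ts0"
  define h where "h = length ts"
  define L where "L j = length (ts ! j) div 2 - 1" for j
  define e where "e j i = ts ! j ! i" for j i
  have dec: "decomp D F ts" using decomp_mset_eq[OF dec0, of ts] by (simp add: ts_def)
  have mem: "ts ! j \<in> set ts" if "j < h" for j using that by (simp add: h_def)
  have tr: "trail D F (ts ! j)" if "j < h" for j
    using dec mem[OF that] by (simp add: decomp_def)
  have ends: "hd (ts ! j) \<in> F" "last (ts ! j) \<in> F" if "j < h" for j
    using ends0 mem[OF that] by (auto simp: ts_def)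
  have len: "length (ts ! j) = 2 * L j + 2" if "j < h" for j
    using trail_length[OF tr[OF that]] by (auto simp: L_def elim!: evenE)
  have hd_e: "hd (ts ! j) = e j 0" and last_e: "last (ts ! j) = e j (2 * L j + 1)" if "j < h" for j
    using trail_not_Nil[OF tr[OF that]] len[OF that] by (simp_all add: e_def hd_conv_nth last_conv_nth)

  let ?I = "SIGMA j:{..<h}. {..<2 * L j + 2}"
  have img: "(\<lambda>(j, i). e j i) ` ?I = D"
  proof -
    have "(\<lambda>(j, i). e j i) ` ?I = (\<Union>j<h. (\<lambda>i. ts ! j ! i) ` {..<length (ts ! j)})"
      by (force simp: e_def len)
    also have "\<dots> = (\<Union>j<h. set (ts ! j))"
      by (auto simp: set_conv_nth)
    also have "\<dots> = set (concat ts)"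
    proof -
      have "set ts = (\<lambda>j. ts ! j) ` {..<h}" by (auto simp: set_conv_nth h_def)
      then show ?thesis by simp
    qed
    finally show ?thesis using dec by (simp add: decomp_def)
  qed
  have card_I: "card D = 2 * (\<Sum>j<h. L j) + 2 * h"
  proof -
    have "card D = length (concat ts)"
      using dec distinct_card unfolding decomp_def by metis
    also have "\<dots> = (\<Sum>j<h. length (ts ! j))"
      by (simp add: length_concat sum_list_sum_nth h_def atLeast0LessThan)
    also have "\<dots> = (\<Sum>j<h. 2 * L j + 2)" by (simp add: len)
    finally show ?thesis unfolding sum.distrib sum_distrib_left by simp
  qed
  have bij: "bij_betw (\<lambda>(j, i). e j i) ?I D"
  proof -
    have "card ?I = (\<Sum>j<h. 2 * L j + 2)" by simp
    then have "card ?I = card D"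
      using card_I unfolding sum.distrib sum_distrib_left by simp
    then have "inj_on (\<lambda>(j, i). e j i) ?I"
      by (intro eq_card_imp_inj_on) (simp_all only: img finite_SigmaI finite_lessThan)
    then show ?thesis using img by (simp add: bij_betw_def)
  qed
  have snd_eq: "snd (e j (2 * i)) = snd (e j (2 * i + 1))" if "j < h" "i \<le> L j" for j i
    using trail_nth[OF tr[OF that(1)]] len[OF that(1)] that by (simp add: e_def)
  have fst_eq: "fst (e j (2 * l + 1)) = fst (e j (2 * l + 2))" if "j < h" "l < L j" for j l
    using trail_nth[OF tr[OF that(1)]] len[OF that(1)] that by (simp add: e_def)
  \<comment> \<open>Both darts of a trail with a single edge would be in \<open>F\<close>, but a
    matching contains at most one dart of each edge.\<close>
  have L_pos: "1 \<le> L j" if j: "j < h" for j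
  proof (rule ccontr)
    assume "\<not> 1 \<le> L j"
    then have "L j = 0" by simp
    then have "snd (e j 0) = snd (e j 1)" using snd_eq[of j 0] j by simp
    moreover have "e j 0 \<in> F" "e j 1 \<in> F"
      using ends[OF j] hd_e[OF j] last_e[OF j] \<open>L j = 0\<close> by simp_all
    ultimately have "e j 0 = e j 1"
      using mat by (auto simp: matching_def dest: inj_onD)
    then have "(j, 0) = (j, 1::nat)"
      using inj_onD[OF bij_betw_imp_inj_on[OF bij], of "(j, 0)" "(j, 1)"] j by auto
    then show False by simp
  qed
  have ends_bij: "bij_betw (\<lambda>(j, b). fst (e j (if b then 0 else 2 * L j + 1))) ({..<h} \<times> UNIV) (fst ` D)"
  proof -
    let ?f = "\<lambda>(j, b). e j (if b then 0 else 2 * L j + 1)"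
    have "inj_on ?f ({..<h} \<times> UNIV)"
    proof (rule inj_onI, clarify)
      fix j b j' b'
      assume "j < h" "j' < h"
        and "e j (if b then 0 else 2 * L j + 1) = e j' (if b' then 0 else 2 * L j' + 1)"
      then have "(j, if b then 0 else 2 * L j + 1) = (j', if b' then 0 else 2 * L j' + 1)"
        by (intro inj_onD[OF bij_betw_imp_inj_on[OF bij]]) auto
      then show "j = j' \<and> b = b'" by (auto split: if_splits)
    qed
    moreover have "?f ` ({..<h} \<times> UNIV) = F"
    proof
      show "?f ` ({..<h} \<times> UNIV) \<subseteq> F"
        using ends hd_e last_e by auto
      show "F \<subseteq> ?f ` ({..<h} \<times> UNIV)"
      proof
        fix f assume f: "f \<in> F"
        then have "f \<in> set (concat ts)" using mat dec by (auto simp: matching_def decomp_def)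
        then obtain t where "t \<in> set ts" "f \<in> set t" by auto
        then obtain j where j: "j < h" "f \<in> set (ts ! j)"
          using in_set_conv_nth[of t ts] by (auto simp: h_def)
        from trail_inner_notin[OF tr[OF j(1)] j(2) f] have "f = ?f (j, True) \<or> f = ?f (j, False)"
          using hd_e last_e j by simp
        then show "f \<in> ?f ` ({..<h} \<times> UNIV)" using j(1) by blast
      qed
    qed
    ultimately have "bij_betw ?f ({..<h} \<times> UNIV) F" by (simp add: bij_betw_def)
    moreover have "bij_betw fst F (fst ` D)" using mat by (simp add: matching_def bij_betw_def)
    ultimately have "bij_betw (fst \<circ> ?f) ({..<h} \<times> UNIV) (fst ` D)" by (rule bij_betw_trans)
    then show ?thesis by (simp add: comp_def case_prod_unfold)
  qed
  have n: "card (fst ` D) = 2 * h"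
    using bij_betw_same_card[OF ends_bij] by simp
  have "(\<Sum>j<h. L j) + h = k * h" using card_I card_D unfolding n by simp
  then have sum_L: "(\<Sum>j<h. L j) = h * (k - 1)"
    using k_ge by (simp add: algebra_simps diff_mult_distrib)
  have c_L: "c (ts ! j) = (if L j = 1 then 0 else if L j = 2 then 2 else 1)" if "j < h" for j
    using len[OF that] by (simp add: c_def)
  have c_mono: "c (ts ! i) \<le> c (ts ! j)" if "i < j" "j < h" for i j
    using that sorted_nth_mono[of "map c ts" i j] by (simp add: ts_def h_def)
  have ones: "L i = 1" if "i < j" "j < h" "L j = 1" for i j
    using c_mono[OF that(1,2)] c_L[of i] c_L[of j] that by (auto split: if_splits)
  have twos: "L j = 2" if "i < j" "j < h" "L i = 2" for i j
    using c_mono[OF that(1,2)] c_L[of i] c_L[of j] that by (auto split: if_splits)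
  show ?thesis
    by (rule that[OF bij L_pos snd_eq fst_eq ends_bij ones twos sum_L])
qed

end

text \<open>Supplies the labels of the trail ends: as \<open>s\<close> decreases when
  \<open>f\<close> increases, \<open>f j - s j\<close> is strictly increasing in \<open>f j\<close>,
  so these differences are distinct.\<close>

lemma decreasing_ranking:
  fixes f :: "nat \<Rightarrow> nat"
  assumes "inj_on f {..<h}"
  obtains s where "bij_betw s {..<h} {1..h}"
    "\<And>i j. i < h \<Longrightarrow> j < h \<Longrightarrow> f i < f j \<Longrightarrow> s j < s i"
proof
  define s where "s j = card {i. i < h \<and> f j \<le> f i}" for j
  show anti: "s j < s i" if "i < h" "j < h" "f i < f j" for i j
    unfolding s_def
  proof (rule psubset_card_mono)
    have "i \<in> {k. k < h \<and> f i \<le> f k} - {k. k < h \<and> f j \<le> f k}" using that by auto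
    moreover have "{k. k < h \<and> f j \<le> f k} \<subseteq> {k. k < h \<and> f i \<le> f k}" using that by auto
    ultimately show "{k. k < h \<and> f j \<le> f k} \<subset> {k. k < h \<and> f i \<le> f k}" by blast
  qed simp
  have inj: "inj_on s {..<h}"
  proof (rule inj_onI)
    fix i j assume ij: "i \<in> {..<h}" "j \<in> {..<h}" "s i = s j"
    then have "f i = f j" using anti[of i j] anti[of j i] by (cases "f i" "f j" rule: linorder_cases) auto
    then show "i = j" using assms ij by (auto dest: inj_onD)
  qed
  have "s ` {..<h} \<subseteq> {1..h}"
  proof clarify
    fix j assume "j < h"
    then have "card {j} \<le> s j" unfolding s_def by (intro card_mono) auto
    moreover have "s j \<le> card {..<h}" unfolding s_def by (intro card_mono) auto
    ultimately show "s j \<in> {1..h}" by simp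
  qed
  then have "s ` {..<h} = {1..h}"
    using inj by (intro card_subset_eq) (simp_all add: card_image)
  then show "bij_betw s {..<h} {1..h}" using inj by (simp add: bij_betw_def)
qed

text \<open>Separates the two ends of a trail from the pairs of darts that meet in a vertex.\<close>

lemma sum_lessThan_pairs:
  fixes w :: "nat \<Rightarrow> nat"
  shows "(\<Sum>i<2 * n + 2. w i) = w 0 + w (2 * n + 1) + (\<Sum>l<n. w (2 * l + 1) + w (2 * l + 2))"
  by (induction n) simp_all

subsection \<open>The labelling\<close>

locale labelled_trails = darts +
  fixes h N :: nat and L :: "nat \<Rightarrow> nat" and e :: "nat \<Rightarrow> nat \<Rightarrow> 'a \<times> 'b"
    and r :: "nat \<Rightarrow> nat \<Rightarrow> nat" and s t :: "nat \<Rightarrow> nat"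
  assumes e_bij: "bij_betw (\<lambda>(j, i). e j i) (SIGMA j:{..<h}. {..<2 * L j + 2}) D"
    and L_pos: "j < h \<Longrightarrow> 1 \<le> L j"
    and snd_e: "j < h \<Longrightarrow> i \<le> L j \<Longrightarrow> snd (e j (2 * i)) = snd (e j (2 * i + 1))"
    and fst_e: "j < h \<Longrightarrow> l < L j \<Longrightarrow> fst (e j (2 * l + 1)) = fst (e j (2 * l + 2))"
    and ends_bij:
      "bij_betw (\<lambda>(j, b). fst (e j (if b then 0 else 2 * L j + 1))) ({..<h} \<times> UNIV) (fst ` D)"
    and N_def: "N = h * (k - 1)"
    and r_bij: "bij_betw (\<lambda>(j, l). r j l) (SIGMA j:{..<h}. {..<L j}) {1..N}"
    and step_inj: "inj_on (\<lambda>(j, l). int (r j (Suc l)) - int (r j l)) (SIGMA j:{..<h}. {..<L j - 1})"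
    and step_cubic: "k = 3 \<Longrightarrow> j < h \<Longrightarrow> l < L j - 1 \<Longrightarrow> int (r j (Suc l)) - int (r j l) \<notin> {1..int h}"
    and s_bij: "bij_betw s {..<h} {1..h}"
    and s_anti: "i < h \<Longrightarrow> j < h \<Longrightarrow> r i 0 < r j 0 \<Longrightarrow> s j < s i"
    and t_bij: "bij_betw t {..<h} {1..h}"
    and t_anti: "i < h \<Longrightarrow> j < h \<Longrightarrow> r i (L i - 1) < r j (L j - 1) \<Longrightarrow> t j < t i"
begin

text \<open>The ends get the labels in \<open>{1..h}\<close> and \<open>{C - h..<C}\<close>. The darts numbered \<open>2 l + 1\<close> and
  \<open>2 l + 2\<close> of a trail meet in a vertex and get labels with sum \<open>C\<close>.\<close>

abbreviation "C \<equiv> 2 * h + 2 * N + 1"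

definition lab :: "nat \<Rightarrow> nat \<Rightarrow> nat" where
  "lab j i = (if i = 0 then C - s j else if i = 2 * L j + 1 then t j
     else if odd i then h + N + r j (i div 2) else h + N + 1 - r j (i div 2 - 1))"

lemma card_D_h: "card D = 2 * h + 2 * N"
proof -
  have "2 * h = card (fst ` D)"
    using bij_betw_same_card[OF ends_bij] by simp
  moreover have "k * (2 * h) = 2 * h + 2 * N"
    using k_ge by (cases k) (simp_all add: N_def)
  ultimately show ?thesis by (simp add: card_D)
qed

lemma r_range: "j < h \<Longrightarrow> l < L j \<Longrightarrow> 1 \<le> r j l \<and> r j l \<le> N"
  using bij_betwE[OF r_bij] by fastforce

lemma s_range: "j < h \<Longrightarrow> 1 \<le> s j \<and> s j \<le> h"
  using bij_betwE[OF s_bij] by fastforce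

lemma t_range: "j < h \<Longrightarrow> 1 \<le> t j \<and> t j \<le> h"
  using bij_betwE[OF t_bij] by fastforce

lemma r_inj: "j < h \<Longrightarrow> l < L j \<Longrightarrow> j' < h \<Longrightarrow> l' < L j' \<Longrightarrow> r j l = r j' l' \<Longrightarrow> j = j' \<and> l = l'"
  using inj_onD[OF bij_betw_imp_inj_on[OF r_bij], of "(j, l)" "(j', l')"] by simp

lemma s_inj: "j < h \<Longrightarrow> j' < h \<Longrightarrow> s j = s j' \<Longrightarrow> j = j'"
  using inj_onD[OF bij_betw_imp_inj_on[OF s_bij], of j j'] by simp

lemma t_inj: "j < h \<Longrightarrow> j' < h \<Longrightarrow> t j = t j' \<Longrightarrow> j = j'"
  using inj_onD[OF bij_betw_imp_inj_on[OF t_bij], of j j'] by simp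

lemma index_cases:
  assumes "i < 2 * L j + 2"
  obtains "i = 0" | "i = 2 * L j + 1" | l where "l < L j" "i = 2 * l + 1" | l where "l < L j" "i = 2 * l + 2"
proof -
  consider "i = 0" | "i = 2 * L j + 1" | "0 < i" "i < 2 * L j + 1" using assms by linarith
  then show ?thesis
  proof cases
    case 3
    show ?thesis
    proof (cases "odd i")
      case True
      then obtain l where "i = 2 * l + 1" by (elim oddE)
      then show ?thesis using that(3) 3 by simp
    next
      case False
      then have "even i" by simp
      then obtain l where "i = 2 * l" by (elim evenE)
      then show ?thesis using that(4)[of "l - 1"] 3 by simp
    qed
  qed (use that in auto)
qed

lemma lab_simps:
  "lab j 0 = C - s j" "lab j (2 * L j + 1) = t j"
  "l < L j \<Longrightarrow> lab j (2 * l + 1) = h + N + r j l"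
  "l < L j \<Longrightarrow> lab j (2 * l + 2) = h + N + 1 - r j l"
  by (auto simp: lab_def)

text \<open>Four intervals are filled: \<open>{1..h}\<close> by the last darts, the next
  \<open>N\<close> labels by the even inner places, the next \<open>N\<close> by the odd ones, and
  the top \<open>h\<close> by the first darts. Injectivity and equal cardinalities then give
  surjectivity.\<close>

lemma lab_bij: "bij_betw (\<lambda>(j, i). lab j i) (SIGMA j:{..<h}. {..<2 * L j + 2}) {1..card D}"
proof -
  let ?I = "SIGMA j:{..<h}. {..<2 * L j + 2}"
  have range: "lab j i \<in> {1..2 * h + 2 * N}" if "j < h" "i < 2 * L j + 2" for j i
    using that(2)
  proof (cases rule: index_cases)
    case 1
    then show ?thesis using s_range[OF that(1)] by (simp add: lab_simps) linarith
  next
    case 2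
    then show ?thesis using t_range[OF that(1)] by (simp add: lab_simps[simplified])
  next
    case (3 l)
    then show ?thesis using r_range[OF that(1) 3(1)] by (simp add: lab_simps[simplified])
  next
    case (4 l)
    then show ?thesis using r_range[OF that(1) 4(1)] by (simp add: lab_simps[simplified]) linarith
  qed
  have inj: "j = j' \<and> i = i'"
    if j: "j < h" "j' < h" and i: "i < 2 * L j + 2" "i' < 2 * L j' + 2" and eq: "lab j i = lab j' i'"
    for j i j' i'
  proof -
    note simps = lab_simps[simplified]
    note range = s_range[OF j(1)] s_range[OF j(2)] t_range[OF j(1)] t_range[OF j(2)]
    note inj = s_inj[OF j] t_inj[OF j]
    note rr = r_range[OF j(1)] r_range[OF j(2)]
    from i(1) show ?thesis
    proof (cases rule: index_cases)
      case 1
      from i(2) show ?thesis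
        by (cases rule: index_cases) (use 1 eq range inj rr in \<open>fastforce simp: simps\<close>)+
    next
      case 2
      from i(2) show ?thesis
        by (cases rule: index_cases) (use 2 eq range inj rr in \<open>fastforce simp: simps\<close>)+
    next
      case (3 l)
      have r: "1 \<le> r j l" "r j l \<le> N" using rr(1)[OF 3(1)] by auto
      from i(2) show ?thesis
      proof (cases rule: index_cases)
        case (3 l')
        then show ?thesis using \<open>l < L j\<close> \<open>i = 2 * l + 1\<close> eq r_inj[OF j(1) \<open>l < L j\<close> j(2), of l']
          by (simp add: simps)
      next
        case (4 l')
        then show ?thesis using \<open>l < L j\<close> \<open>i = 2 * l + 1\<close> eq r rr(2)[OF 4(1)]
          by (simp add: simps) linarith
      qed (use 3 eq range r in \<open>auto simp: simps\<close>)
    next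
      case (4 l)
      have r: "1 \<le> r j l" "r j l \<le> N" using rr(1)[OF 4(1)] by auto
      from i(2) show ?thesis
      proof (cases rule: index_cases)
        case (3 l')
        then show ?thesis using \<open>l < L j\<close> \<open>i = 2 * l + 2\<close> eq r rr(2)[OF 3(1)]
          by (simp add: simps) linarith
      next
        case (4 l')
        then show ?thesis using \<open>l < L j\<close> \<open>i = 2 * l + 2\<close> eq r rr(2)[OF 4(1)]
            r_inj[OF j(1) \<open>l < L j\<close> j(2), of l']
          by (simp add: simps)
      qed (use 4 eq range r in \<open>auto simp: simps\<close>)
    qed
  qed
  have "inj_on (\<lambda>(j, i). lab j i) ?I"
  proof (rule inj_onI)
    fix p p' assume "p \<in> ?I" "p' \<in> ?I" "(case p of (j, i) \<Rightarrow> lab j i) = (case p' of (j, i) \<Rightarrow> lab j i)"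
    then show "p = p'"
      using inj[of "fst p" "fst p'" "snd p" "snd p'"] by (cases p, cases p') simp
  qed
  moreover have "(\<lambda>(j, i). lab j i) ` ?I \<subseteq> {1..card D}"
    using range by (auto simp: card_D_h)
  moreover have "card ?I = card {1..card D}"
    using bij_betw_same_card[OF e_bij] by simp
  ultimately show ?thesis
    unfolding bij_betw_def by (metis card_image card_subset_eq finite_atLeastAtMost)
qed

definition g :: "'a \<times> 'b \<Rightarrow> nat" where
  "g d = (case inv_into (SIGMA j:{..<h}. {..<2 * L j + 2}) (\<lambda>(j, i). e j i) d of (j, i) \<Rightarrow> lab j i)"

lemma g_e: "j < h \<Longrightarrow> i < 2 * L j + 2 \<Longrightarrow> g (e j i) = lab j i"
  using bij_betw_inv_into_left[OF e_bij, of "(j, i)"] by (simp add: g_def)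

lemma g_bij: "bij_betw g D {1..card D}"
  using bij_betw_trans[OF bij_betw_inv_into[OF e_bij] lab_bij]
  by (simp add: g_def[abs_def] comp_def case_prod_unfold)

section \<open>Sums at the edges of the multigraph, measured from \<open>C\<close>\<close>

definition ysum :: "nat \<Rightarrow> nat \<Rightarrow> int" where
  "ysum j i = int (lab j (2 * i)) + int (lab j (2 * i + 1)) - int C"

text \<open>The first edge has a top end label and a high pair label, the last edge a low pair label
  and a bottom end label. An inner edge combines the low label of pair \<open>l\<close> with the
  high label of pair \<open>Suc l\<close>, so only the rank difference survives. As
  \<open>1 \<le> L j\<close>, the first edge is not the last.\<close>

lemma ysum_cases:
  assumes "j < h" "i \<le> L j"
  obtains "i = 0" "ysum j i = int (h + N + r j 0) - int (s j)" "int N < ysum j i" "ysum j i < int (h + 2 * N)"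
  | "i = L j" "ysum j i = - (int (h + N + r j (L j - 1)) - int (t j))" "ysum j i < - int N"
  | l where "l < L j - 1" "i = Suc l" "ysum j i = int (r j (Suc l)) - int (r j l)" "\<bar>ysum j i\<bar> < int N"
proof -
  note L = L_pos[OF assms(1)]
  consider "i = 0" | "i = L j" "0 < i" | "0 < i" "i < L j" using assms by linarith
  then show ?thesis
  proof cases
    case 1
    have "lab j 1 = h + N + r j 0" using lab_simps(3)[of 0 j] L by simp
    then show ?thesis
      using that(1) 1 L s_range[OF assms(1)] r_range[OF assms(1), of 0]
      by (simp add: ysum_def lab_simps of_nat_diff)
  next
    case 2
    have i: "2 * (i - 1) + 2 = 2 * i" using 2 by simp
    have "lab j (2 * i) = h + N + 1 - r j (L j - 1)"
      using lab_simps(4)[of "i - 1" j] 2 unfolding i by simp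
    then show ?thesis
      using that(2) 2 t_range[OF assms(1)] r_range[OF assms(1), of "L j - 1"]
      by (simp add: ysum_def lab_simps[simplified] of_nat_diff)
  next
    case 3
    then obtain l where l: "i = Suc l" by (cases i) auto
    have lab: "lab j (2 * i) = h + N + 1 - r j l" "lab j (2 * i + 1) = h + N + r j i"
      using lab_simps(4)[of l j] lab_simps(3)[of i j] 3 l by simp_all
    have "l < L j - 1" using 3 l by simp
    moreover note l
    moreover have "ysum j i = int (r j (Suc l)) - int (r j l)" "\<bar>ysum j i\<bar> < int N"
      using r_range[OF assms(1), of l] r_range[OF assms(1), of i] 3 l
      unfolding ysum_def lab by (simp_all add: of_nat_diff) linarith
    ultimately show ?thesis by (rule that(3))
  qed
qed

lemma start_inj: "j < h \<Longrightarrow> j' < h \<Longrightarrow> int (r j 0) - int (s j) = int (r j' 0) - int (s j') \<Longrightarrow> j = j'"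
  using s_anti[of j j'] s_anti[of j' j] r_inj[of j 0 j' 0] L_pos[of j] L_pos[of j']
  by (cases "r j 0" "r j' 0" rule: linorder_cases) auto

lemma stop_inj: "j < h \<Longrightarrow> j' < h \<Longrightarrow>
    int (r j (L j - 1)) - int (t j) = int (r j' (L j' - 1)) - int (t j') \<Longrightarrow> j = j'"
  using t_anti[of j j'] t_anti[of j' j] r_inj[of j "L j - 1" j' "L j' - 1"] L_pos[of j] L_pos[of j']
  by (cases "r j (L j - 1)" "r j' (L j' - 1)" rule: linorder_cases) auto

text \<open>The first, inner and last edges have values above \<open>N\<close>, strictly between
  \<open>-N\<close> and \<open>N\<close>, and below \<open>-N\<close>. Within the three classes,
  \<open>start_inj\<close>, \<open>step_inj\<close> and \<open>stop_inj\<close> apply.\<close>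

lemma ysum_inj:
  assumes "j < h" "i \<le> L j" "j' < h" "i' \<le> L j'" and eq: "ysum j i = ysum j' i'"
  shows "j = j' \<and> i = i'"
  using assms(1,2)
proof (cases rule: ysum_cases)
  case 1
  from assms(3,4) show ?thesis
    by (cases rule: ysum_cases) (use 1 eq start_inj[OF assms(1,3)] in auto)
next
  case 2
  from assms(3,4) show ?thesis
    by (cases rule: ysum_cases) (use 2 eq stop_inj[OF assms(1,3)] in auto)
next
  case (3 l)
  from assms(3,4) show ?thesis
  proof (cases rule: ysum_cases)
    case (3 l')
    then have "(j, l) = (j', l')"
      using inj_onD[OF step_inj, of "(j, l)" "(j', l')"] assms(1,3) eq
        \<open>l < L j - 1\<close> \<open>ysum j i = int (r j (Suc l)) - int (r j l)\<close> by simp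
    then show ?thesis using 3 \<open>i = Suc l\<close> by simp
  qed (use 3 eq in auto)
qed

lemma dart_pair:
  assumes "y \<in> snd ` D"
  obtains j i where "j < h" "i \<le> L j" "y = snd (e j (2 * i))"
    "int (\<Sum>d | d \<in> D \<and> snd d = y. g d) = ysum j i + int C"
proof -
  obtain j i0 where j: "j < h" "i0 < 2 * L j + 2" "y = snd (e j i0)"
    using assms bij_betw_imp_surj_on[OF e_bij] by (force simp: image_iff)
  define i where "i = i0 div 2"
  have i: "i \<le> L j" and "i0 = 2 * i \<or> i0 = 2 * i + 1" using j(2) by (auto simp: i_def)
  then have y: "y = snd (e j (2 * i))" using snd_e[OF j(1) i] j(3) by auto
  have mem: "e j (2 * i) \<in> D" "e j (2 * i + 1) \<in> D"
    using bij_betwE[OF e_bij] j(1) i by force+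
  have neq: "e j (2 * i) \<noteq> e j (2 * i + 1)"
    using inj_onD[OF bij_betw_imp_inj_on[OF e_bij], of "(j, 2 * i)" "(j, 2 * i + 1)"] j(1) i by auto
  have "{d \<in> D. snd d = y} = {e j (2 * i), e j (2 * i + 1)}"
    using darts_of_y[OF mem neq snd_e[OF j(1) i]] y by simp
  then have "int (\<Sum>d | d \<in> D \<and> snd d = y. g d) = ysum j i + int C"
    using neq g_e[OF j(1), of "2 * i"] g_e[OF j(1), of "2 * i + 1"] i by (simp add: ysum_def)
  then show ?thesis using that j(1) i y by blast
qed

lemma inj_on_sum_snd: "inj_on (\<lambda>y. \<Sum>d | d \<in> D \<and> snd d = y. g d) (snd ` D)"
proof (rule inj_onI)
  fix y y' assume y: "y \<in> snd ` D" "y' \<in> snd ` D"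
    and eq: "(\<Sum>d | d \<in> D \<and> snd d = y. g d) = (\<Sum>d | d \<in> D \<and> snd d = y'. g d)"
  obtain j i where 1: "j < h" "i \<le> L j" "y = snd (e j (2 * i))"
    "int (\<Sum>d | d \<in> D \<and> snd d = y. g d) = ysum j i + int C"
    using dart_pair[OF y(1)] by blast
  obtain j' i' where 2: "j' < h" "i' \<le> L j'" "y' = snd (e j' (2 * i'))"
    "int (\<Sum>d | d \<in> D \<and> snd d = y'. g d) = ysum j' i' + int C"
    using dart_pair[OF y(2)] by blast
  have "ysum j i = ysum j' i'" using 1(4) 2(4) eq by linarith
  then show "y = y'" using ysum_inj[OF 1(1,2) 2(1,2)] 1(3) 2(3) by simp
qed

section \<open>Sums at the vertices of the multigraph\<close>

definition end_lab :: "nat \<times> bool \<Rightarrow> nat" where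
  "end_lab = (\<lambda>(j, b). if b then C - s j else t j)"

definition end_of :: "'a \<Rightarrow> nat \<times> bool" where
  "end_of = inv_into ({..<h} \<times> UNIV) (\<lambda>(j, b). fst (e j (if b then 0 else 2 * L j + 1)))"

lemma end_of:
  assumes "x \<in> fst ` D"
  shows "end_of x \<in> {..<h} \<times> UNIV"
    and "(\<lambda>(j, b). fst (e j (if b then 0 else 2 * L j + 1))) (end_of x) = x"
proof -
  have x: "x \<in> (\<lambda>(j, b). fst (e j (if b then 0 else 2 * L j + 1))) ` ({..<h} \<times> UNIV)"
    unfolding bij_betw_imp_surj_on[OF ends_bij] by (rule assms)
  show "end_of x \<in> {..<h} \<times> UNIV"
    unfolding end_of_def by (rule inv_into_into[OF x])
  show "(\<lambda>(j, b). fst (e j (if b then 0 else 2 * L j + 1))) (end_of x) = x"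
    unfolding end_of_def by (rule f_inv_into_f[OF x])
qed

text \<open>Counts the pairs of darts linked at \<open>x\<close>, each once, by its odd-numbered
  dart.\<close>

definition links :: "'a \<Rightarrow> nat" where
  "links x = (\<Sum>j<h. \<Sum>l<L j. if fst (e j (2 * l + 1)) = x then 1 else 0)"

text \<open>The darts at \<open>x\<close> are one trail end and both members of every pair linked
  there. The weights are general because weight 1 relates \<open>links x\<close> to the degree,
  while the labels give the vertex sum.\<close>

lemma sum_darts_at:
  fixes w :: "nat \<Rightarrow> nat \<Rightarrow> nat"
  assumes "x \<in> fst ` D"
    and w: "\<And>j i. j < h \<Longrightarrow> i < 2 * L j + 2 \<Longrightarrow> f (e j i) = w j i"
    and c: "\<And>j l. j < h \<Longrightarrow> l < L j \<Longrightarrow> w j (2 * l + 1) + w j (2 * l + 2) = c"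
  shows "(\<Sum>d | d \<in> D \<and> fst d = x. f d) =
    (case end_of x of (j, b) \<Rightarrow> w j (if b then 0 else 2 * L j + 1)) + c * links x"
proof -
  let ?W = "\<lambda>(j, b). w j (if b then 0 else 2 * L j + 1)"
  let ?v = "\<lambda>(j, b). fst (e j (if b then 0 else 2 * L j + 1))"
  have "(\<Sum>d | d \<in> D \<and> fst d = x. f d) = (\<Sum>d\<in>D. if fst d = x then f d else 0)"
    by (rule sum.inter_filter[OF finite_D])
  also have "\<dots> = (\<Sum>p\<in>(SIGMA j:{..<h}. {..<2 * L j + 2}).
      (\<lambda>d. if fst d = x then f d else 0) (case p of (j, i) \<Rightarrow> e j i))"
    by (rule sum.reindex_bij_betw[OF e_bij, symmetric])
  also have "\<dots> = (\<Sum>(j, i)\<in>(SIGMA j:{..<h}. {..<2 * L j + 2}). if fst (e j i) = x then w j i else 0)"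
    by (rule sum.cong) (auto simp: w)
  also have "\<dots> = (\<Sum>j<h. \<Sum>i<2 * L j + 2. if fst (e j i) = x then w j i else 0)"
    by (rule sum.Sigma[symmetric]) auto
  also have "\<dots> = (\<Sum>j<h. (\<Sum>b\<in>UNIV. if ?v (j, b) = x then ?W (j, b) else 0)
      + c * (\<Sum>l<L j. if fst (e j (2 * l + 1)) = x then 1 else 0))"
  proof (rule sum.cong[OF refl])
    fix j assume "j \<in> {..<h}"
    then have "(\<Sum>l<L j. (if fst (e j (2 * l + 1)) = x then w j (2 * l + 1) else 0)
        + (if fst (e j (2 * l + 2)) = x then w j (2 * l + 2) else 0))
      = (\<Sum>l<L j. c * (if fst (e j (2 * l + 1)) = x then 1 else 0))"
      using fst_e[of j] c[of j] by (intro sum.cong) auto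
    then show "(\<Sum>i<2 * L j + 2. if fst (e j i) = x then w j i else 0) =
        (\<Sum>b\<in>UNIV. if ?v (j, b) = x then ?W (j, b) else 0)
        + c * (\<Sum>l<L j. if fst (e j (2 * l + 1)) = x then 1 else 0)"
      unfolding sum_lessThan_pairs sum_distrib_left by (simp add: UNIV_bool)
  qed
  also have "\<dots> = (\<Sum>p\<in>{..<h} \<times> UNIV. if ?v p = x then ?W p else 0) + c * links x"
    by (simp add: sum.distrib sum.cartesian_product links_def sum_distrib_left)
      (auto intro!: sum.cong)
  also have "(\<Sum>p\<in>{..<h} \<times> UNIV. if ?v p = x then ?W p else 0) = ?W (end_of x)"
  proof -
    have "?v p = x \<longleftrightarrow> p = end_of x" if "p \<in> {..<h} \<times> UNIV" for p
      using inj_on_eq_iff[OF bij_betw_imp_inj_on[OF ends_bij] that end_of(1)[OF assms(1)]]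
      unfolding end_of(2)[OF assms(1)] .
    then have "(\<Sum>p\<in>{..<h} \<times> UNIV. if ?v p = x then ?W p else 0)
        = (\<Sum>p\<in>{..<h} \<times> UNIV. if p = end_of x then ?W p else 0)"
      by (intro sum.cong) simp_all
    also have "\<dots> = ?W (end_of x)"
      using end_of(1)[OF assms(1)] by (subst sum.delta) (simp_all only: finite_lessThan finite_cartesian_product finite_UNIV if_True finite simp_thms)
    finally show ?thesis .
  qed
  finally show ?thesis by (simp add: case_prod_unfold)
qed

lemma links_eq:
  assumes "x \<in> fst ` D"
  shows "k = 1 + 2 * links x"
proof -
  have "(\<Sum>d | d \<in> D \<and> fst d = x. 1) = (case end_of x of (j, b) \<Rightarrow> 1) + 2 * links x"
    using sum_darts_at[OF assms, of "\<lambda>_. 1" "\<lambda>_ _. 1" 2] by simp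
  then show ?thesis
    using card_x[OF assms] by (simp split: prod.splits)
qed

lemma sum_fst:
  assumes "x \<in> fst ` D"
  shows "(\<Sum>d | d \<in> D \<and> fst d = x. g d) = end_lab (end_of x) + C * links x"
proof -
  have "lab j (2 * l + 1) + lab j (2 * l + 2) = C" if "j < h" "l < L j" for j l
    using r_range[OF that] unfolding lab_simps(3,4)[OF that(2)] by linarith
  from sum_darts_at[OF assms g_e this]
  have "(\<Sum>d | d \<in> D \<and> fst d = x. g d) =
      (case end_of x of (j, b) \<Rightarrow> lab j (if b then 0 else 2 * L j + 1)) + C * links x" .
  moreover have "(case p of (j, b) \<Rightarrow> lab j (if b then 0 else 2 * L j + 1)) = end_lab p" for p
    unfolding end_lab_def by (cases p; cases "snd p") (simp_all only: prod.case snd_conv if_True if_False lab_simps(1,2))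
  ultimately show ?thesis by (simp only:)
qed

lemma inj_on_end_lab: "inj_on end_lab ({..<h} \<times> UNIV)"
proof (rule inj_onI, clarify)
  fix j b j' b' assume "j < h" "j' < h" "end_lab (j, b) = end_lab (j', b')"
  then show "j = j' \<and> b = b'"
    using s_range[of j] s_range[of j'] t_range[of j] t_range[of j'] s_inj[of j j'] t_inj[of j j']
    by (auto simp: end_lab_def split: if_splits)
qed

lemma inj_on_sum_fst: "inj_on (\<lambda>x. \<Sum>d | d \<in> D \<and> fst d = x. g d) (fst ` D)"
proof (rule inj_onI)
  fix x x' assume x: "x \<in> fst ` D" "x' \<in> fst ` D"
    and eq: "(\<Sum>d | d \<in> D \<and> fst d = x. g d) = (\<Sum>d | d \<in> D \<and> fst d = x'. g d)"
  have "links x = links x'" using links_eq[OF x(1)] links_eq[OF x(2)] by simp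
  then have "end_lab (end_of x) = end_lab (end_of x')" using sum_fst x eq by simp
  then have ends: "end_of x = end_of x'"
    by (rule inj_onD[OF inj_on_end_lab _ end_of(1)[OF x(1)] end_of(1)[OF x(2)]])
  show "x = x'"
    using end_of(2)[OF x(1)] unfolding ends end_of(2)[OF x(2)] by (rule sym)
qed

text \<open>With two or more links the vertex sum is at least \<open>2 * C\<close>, above every edge
  sum. With one link, \<open>k = 3\<close> and \<open>N = 2 * h\<close>; the vertex sum is
  \<open>C\<close> plus an end label, which is at most \<open>h\<close> or above
  \<open>h + 2 * N\<close>. First edges fall between these ranges, last edges are negative, and
  inner edges avoid \<open>{1..h}\<close> by \<open>step_cubic\<close>.\<close>

lemma sum_fst_neq_sum_snd:
  assumes "x \<in> fst ` D" "y \<in> snd ` D"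
  shows "(\<Sum>d | d \<in> D \<and> fst d = x. g d) \<noteq> (\<Sum>d | d \<in> D \<and> snd d = y. g d)"
proof
  assume eq: "(\<Sum>d | d \<in> D \<and> fst d = x. g d) = (\<Sum>d | d \<in> D \<and> snd d = y. g d)"
  obtain j i where ji: "j < h" "i \<le> L j"
    and y: "int (\<Sum>d | d \<in> D \<and> snd d = y. g d) = ysum j i + int C"
    using dart_pair[OF assms(2)] by blast
  have less: "ysum j i < int (h + 2 * N)"
    using ji by (cases rule: ysum_cases) auto
  have x: "int (end_lab (end_of x)) + int C * int (links x) = ysum j i + int C"
    unfolding of_nat_mult[symmetric] of_nat_add[symmetric]
    using y eq sum_fst[OF assms(1)] by (simp only:)
  have "links x = 1"
  proof (rule ccontr)
    assume "links x \<noteq> 1"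
    then have "2 \<le> links x" using links_eq[OF assms(1)] k_ge by linarith
    then have "int C * 2 \<le> int C * int (links x)" by (intro mult_left_mono) auto
    then show False using x less by simp
  qed
  then have k: "k = 3" using links_eq[OF assms(1)] by simp
  have N: "N = 2 * h" using N_def k by simp
  have eq': "ysum j i = int (end_lab (end_of x))" using x \<open>links x = 1\<close> by simp
  obtain j' b where "end_of x = (j', b)" "j' < h"
    using end_of(1)[OF assms(1)] by (cases "end_of x") auto
  then have lab: "1 \<le> end_lab (end_of x) \<and> end_lab (end_of x) \<le> h \<or> h + 2 * N < end_lab (end_of x)"
    using s_range[of j'] t_range[of j'] by (auto simp: end_lab_def)
  from ji show False
  proof (cases rule: ysum_cases)
    case 1
    then show ?thesis using lab eq' N by (elim disjE conjE) linarith+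
  next
    case 2
    then show ?thesis using eq' by linarith
  next
    case (3 l)
    have "ysum j i \<notin> {1..int h}" using step_cubic[OF k ji(1) 3(1)] 3(3) by simp
    then show ?thesis using 3(4) lab eq' unfolding atLeastAtMost_iff by linarith
  qed
qed

end

section \<open>Assembling the labelling, and transfer to the bipartite graph\<close>

lemma (in darts) labelling_exists:
  "\<exists>g. bij_betw g D {1..card D} \<and>
     inj_on (\<lambda>x. \<Sum>d | d \<in> D \<and> fst d = x. g d) (fst ` D) \<and>
     inj_on (\<lambda>y. \<Sum>d | d \<in> D \<and> snd d = y. g d) (snd ` D) \<and>
     (\<forall>x\<in>fst ` D. \<forall>y\<in>snd ` D.
        (\<Sum>d | d \<in> D \<and> fst d = x. g d) \<noteq> (\<Sum>d | d \<in> D \<and> snd d = y. g d))"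
proof -
  obtain h L e where
    e: "bij_betw (\<lambda>(j, i). e j i) (SIGMA j:{..<h}. {..<2 * L j + 2}) D"
      "\<And>j. j < h \<Longrightarrow> 1 \<le> L j"
      "\<And>j i. j < h \<Longrightarrow> i \<le> L j \<Longrightarrow> snd (e j (2 * i)) = snd (e j (2 * i + 1))"
      "\<And>j l. j < h \<Longrightarrow> l < L j \<Longrightarrow> fst (e j (2 * l + 1)) = fst (e j (2 * l + 2))"
      "bij_betw (\<lambda>(j, b). fst (e j (if b then 0 else 2 * L j + 1))) ({..<h} \<times> UNIV) (fst ` D)"
    and ones: "\<And>i j. i < j \<Longrightarrow> j < h \<Longrightarrow> L j = 1 \<Longrightarrow> L i = 1"
    and twos: "\<And>i j. i < j \<Longrightarrow> j < h \<Longrightarrow> L i = 2 \<Longrightarrow> L j = 2"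
    and sum_L: "(\<Sum>j<h. L j) = h * (k - 1)"
    by (rule indexed_decomp_exists) (rule that)
  obtain r where
    r: "bij_betw (\<lambda>(j, l). r j l) (SIGMA j:{..<h}. {..<L j}) {1..h * (k - 1)}"
      "inj_on (\<lambda>(j, l). int (r j (Suc l)) - int (r j l)) (SIGMA j:{..<h}. {..<L j - 1})"
      "\<And>j l. k = 3 \<Longrightarrow> j < h \<Longrightarrow> l < L j - 1 \<Longrightarrow> int (r j (Suc l)) - int (r j l) \<notin> {1..int h}"
  proof (cases "k = 3")
    case True
    then have N: "h * (k - 1) = 2 * h" by simp
    note r_that = that
    show ?thesis
    proof (rule graceful_rank_cubic)
      show "(\<Sum>j<h. L j) = 2 * h" using sum_L N by simp
      show "1 \<le> L j" if "j < h" for j by (rule e(2)[OF that])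
      show "L i = 1" if "i < j" "j < h" "L j = 1" for i j by (rule ones[OF that])
      show "L j = 2" if "i < j" "j < h" "L i = 2" for i j by (rule twos[OF that])
    next
      fix r :: "nat \<Rightarrow> nat \<Rightarrow> nat"
      assume r: "bij_betw (\<lambda>(j, l). r j l) (SIGMA j:{..<h}. {..<L j}) {1..2 * h}"
        "inj_on (\<lambda>(j, l). int (r j (Suc l)) - int (r j l)) (SIGMA j:{..<h}. {..<L j - 1})"
        "\<And>j l. j < h \<Longrightarrow> l < L j - 1 \<Longrightarrow> int (r j (Suc l)) - int (r j l) \<notin> {1..int h}"
      show thesis
        by (rule r_that[of r]) (use r N in \<open>simp_all only: not_False_eq_True\<close>)
    qed
  next
    case False
    show ?thesis
      by (rule graceful_rank_large[OF sum_L[symmetric]]) (rule that, simp_all only: False)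
  qed
  have r_inj: "j = j'" if "j < h" "j' < h" "l < L j" "l' < L j'" "r j l = r j' l'" for j j' l l'
    using inj_onD[OF bij_betw_imp_inj_on[OF r(1)], of "(j, l)" "(j', l')"] that by simp
  have "inj_on (\<lambda>j. r j 0) {..<h}"
    by (rule inj_onI, rule r_inj[where l = 0 and l' = 0]) (use e(2) in \<open>auto simp: Suc_le_eq\<close>)
  then obtain s where s: "bij_betw s {..<h} {1..h}"
    "\<And>i j. i < h \<Longrightarrow> j < h \<Longrightarrow> r i 0 < r j 0 \<Longrightarrow> s j < s i"
    by (rule decreasing_ranking) (rule that)
  have "inj_on (\<lambda>j. r j (L j - 1)) {..<h}"
    by (rule inj_onI, rule r_inj) (use e(2) in \<open>auto simp: Suc_le_eq\<close>)
  then obtain t where t: "bij_betw t {..<h} {1..h}"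
    "\<And>i j. i < h \<Longrightarrow> j < h \<Longrightarrow> r i (L i - 1) < r j (L j - 1) \<Longrightarrow> t j < t i"
    by (rule decreasing_ranking) (rule that)
  interpret labelled_trails D k h "h * (k - 1)" L e r s t
    by unfold_locales (fact e r s t refl)+
  show ?thesis
    using g_bij inj_on_sum_fst inj_on_sum_snd sum_fst_neq_sum_snd by blast
qed

theorem theorem2:
  fixes X Y :: "'a set" and E :: "'a set set" and k :: nat
  assumes "k \<ge> 3" and "odd k"
    and "biregular_bipartite_graph k 2 X Y E"
  shows "antimagic (X \<union> Y) E"
proof -
  have fin: "finite (X \<union> Y)" and disj: "X \<inter> Y = {}"
    and E: "\<And>e. e \<in> E \<Longrightarrow> \<exists>x\<in>X. \<exists>y\<in>Y. e = {x, y}"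
    and degX: "\<And>x. x \<in> X \<Longrightarrow> graph_degree E x = k"
    and degY: "\<And>y. y \<in> Y \<Longrightarrow> graph_degree E y = 2"
    using assms(3)
    unfolding biregular_bipartite_graph_def bipartite_graph_def simple_graph_def by auto
  \<comment> \<open>Orienting every edge from \<open>X\<close> to \<open>Y\<close> yields the darts.
    Since the degrees \<open>k\<close> and 2 are positive, the projections of \<open>D\<close> are
    all of \<open>X\<close> and \<open>Y\<close>.\<close>
  define D where "D = {(x, y). x \<in> X \<and> y \<in> Y \<and> {x, y} \<in> E}"
  have "D \<subseteq> X \<times> Y" by (auto simp: D_def)
  then have "finite D" using fin by (auto intro: finite_subset)
  have nbX: "v \<in> Y" if "x \<in> X" "{x, v} \<in> E" for x v
    using E[OF that(2)] that(1) disj by (auto simp: doubleton_eq_iff)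
  have nbY: "v \<in> X" if "y \<in> Y" "{y, v} \<in> E" for y v
    using E[OF that(2)] that(1) disj by (auto simp: doubleton_eq_iff)
  have atX: "bij_betw (Pair x) {v. {x, v} \<in> E} {d \<in> D. fst d = x}" if "x \<in> X" for x
    using that nbX by (auto simp: bij_betw_def inj_on_def D_def)
  have atY: "bij_betw (\<lambda>v. (v, y)) {v. {y, v} \<in> E} {d \<in> D. snd d = y}" if "y \<in> Y" for y
    using that nbY by (auto simp: bij_betw_def inj_on_def D_def insert_commute)
  have cardX: "card {d \<in> D. fst d = x} = k" if "x \<in> X" for x
    using bij_betw_same_card[OF atX[OF that]] degX[OF that] by (simp add: graph_degree_def)
  have cardY: "card {d \<in> D. snd d = y} = 2" if "y \<in> Y" for y
    using bij_betw_same_card[OF atY[OF that]] degY[OF that] by (simp add: graph_degree_def)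
  have fst_D: "fst ` D = X"
  proof
    show "X \<subseteq> fst ` D"
    proof
      fix x assume "x \<in> X"
      then have "{d \<in> D. fst d = x} \<noteq> {}" using cardX[of x] assms(1) by (metis card.empty not_numeral_le_zero)
      then show "x \<in> fst ` D" by blast
    qed
  qed (auto simp: D_def)
  have snd_D: "snd ` D = Y"
  proof
    show "Y \<subseteq> snd ` D"
    proof
      fix y assume "y \<in> Y"
      then have "{d \<in> D. snd d = y} \<noteq> {}" using cardY[of y] by (metis card.empty zero_neq_numeral)
      then show "y \<in> snd ` D" by blast
    qed
  qed (auto simp: D_def)
  interpret darts D k
    using \<open>finite D\<close> cardX cardY assms(1,2) by unfold_locales (simp_all only: fst_D snd_D not_False_eq_True)
  obtain g where g: "bij_betw g D {1..card D}"
    and gX: "inj_on (\<lambda>x. \<Sum>d | d \<in> D \<and> fst d = x. g d) X"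
    and gY: "inj_on (\<lambda>y. \<Sum>d | d \<in> D \<and> snd d = y. g d) Y"
    and gXY: "\<And>x y. x \<in> X \<Longrightarrow> y \<in> Y \<Longrightarrow>
        (\<Sum>d | d \<in> D \<and> fst d = x. g d) \<noteq> (\<Sum>d | d \<in> D \<and> snd d = y. g d)"
    using labelling_exists unfolding fst_D snd_D by blast
  let ?edge = "\<lambda>(x, y). {x, y}"
  have edge: "bij_betw ?edge D E"
  proof -
    have "inj_on ?edge D"
      using disj by (auto simp: inj_on_def D_def doubleton_eq_iff)
    moreover have "?edge ` D = E"
    proof
      show "E \<subseteq> ?edge ` D"
      proof
        fix e assume "e \<in> E"
        then obtain x y where "x \<in> X" "y \<in> Y" "e = {x, y}" using E by blast
        then show "e \<in> ?edge ` D" using \<open>e \<in> E\<close> by (auto simp: D_def image_iff)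
      qed
    qed (auto simp: D_def)
    ultimately show ?thesis by (simp add: bij_betw_def)
  qed
  define f where "f = g \<circ> inv_into D ?edge"
  have f: "f {x, y} = g (x, y)" if "(x, y) \<in> D" for x y
    using bij_betw_inv_into_left[OF edge that] by (simp add: f_def)
  have "bij_betw f E {1..card E}"
    using bij_betw_trans[OF bij_betw_inv_into[OF edge] g] bij_betw_same_card[OF edge]
    by (simp add: f_def)
  moreover have sumX: "vertex_sum E f x = (\<Sum>d | d \<in> D \<and> fst d = x. g d)" if "x \<in> X" for x
    unfolding vertex_sum_def sum.reindex_bij_betw[OF atX[OF that], symmetric]
    using that nbX by (intro sum.cong) (auto simp: D_def intro!: f)
  moreover have sumY: "vertex_sum E f y = (\<Sum>d | d \<in> D \<and> snd d = y. g d)" if "y \<in> Y" for y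
    unfolding vertex_sum_def sum.reindex_bij_betw[OF atY[OF that], symmetric]
    using that nbY f by (intro sum.cong) (auto simp: D_def insert_commute)
  have "inj_on (vertex_sum E f) (X \<union> Y)"
  proof (rule inj_onI)
    fix u v assume uv: "u \<in> X \<union> Y" "v \<in> X \<union> Y" "vertex_sum E f u = vertex_sum E f v"
    consider "u \<in> X" "v \<in> X" | "u \<in> X" "v \<in> Y" | "u \<in> Y" "v \<in> X" | "u \<in> Y" "v \<in> Y"
      using uv by blast
    then show "u = v"
    proof cases
      case 1
      then show ?thesis using inj_onD[OF gX, of u v] uv(3) by (simp add: sumX)
    next
      case 2
      then show ?thesis using gXY[of u v] uv(3) by (simp add: sumX sumY)
    next
      case 3
      then show ?thesis using gXY[of v u] uv(3) by (simp add: sumX sumY)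
    next
      case 4
      then show ?thesis using inj_onD[OF gY, of u v] uv(3) by (simp add: sumY)
    qed
  qed
  ultimately show ?thesis
    unfolding antimagic_def antimagic_labelling_def by blast
qed

end
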